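(* For every integer $c\ge 3$ there exist two non-isomorphic connected unicyclic graphs $G$ and $H$, each having its unique cycle of length $c$ (so each of girth $c$), such that $\mathbf{X}_G=\mathbf{X}_H$. That is, the chromatic symmetric function does not distinguish $c$-unicyclic graphs for any $c\ge 3$.
   Context: All graphs are finite and simple. A unicyclic graph is a connected graph containing exactly one cycle; it is $c$-unicyclic if that cycle has $c$ vertices. The chromatic symmetric function of a graph $G$ with vertex set $V=\{v_1,\dots,v_n\}$ is $\mathbf{X}_G=\sum_{\kappa}x_{\kappa(v_1)}\cdots x_{\kappa(v_n)}$, where $\kappa:V\to\mathbb{N}$ ranges over all proper colorings of $G$ and $x_i$ ($i\in\mathbb{N}$) are commuting variables. *)

theory Defs
  imports
    "Graph_Theory.Pair_Digraph"
    "Graph_Theory.Digraph_Component"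
    "Graph_Theory.Digraph_Isomorphism"
    "HOL-Library.Poly_Mapping"
    "HOL-Library.FuncSet"
    "HOL-Library.Extended_Nat"
begin

text \<open>
  A finite simple graph is a \<open>pair_graph\<close>: a finite vertex set with a symmetric irreflexive
  relation \<open>parcs\<close>, so an edge \<open>uv\<close> is the pair of arcs \<open>(u, v)\<close>, \<open>(v, u)\<close>.
\<close>

text \<open>
  The library's \<open>cycle\<close> is a closed directed walk, and in a symmetric digraph every edge yields
  one of length 2; hence the bound \<open>3 \<le> length p\<close>. Walks differing only in starting point or
  direction trace the same cycle, so cycles are counted as subgraphs.
\<close>

definition subgraph_of_walk :: "('a \<times> 'a) list \<Rightarrow> 'a pair_pre_digraph" where
  "subgraph_of_walk p = \<lparr> pverts = fst ` set p \<union> snd ` set p, parcs = set p \<union> (set p)\<inverse> \<rparr>"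

definition cycle_subgraphs :: "'a pair_pre_digraph \<Rightarrow> 'a pair_pre_digraph set" where
  "cycle_subgraphs G =
     {subgraph_of_walk p | p. pre_digraph.cycle (with_proj G) p \<and> 3 \<le> length p}"

definition unicyclic :: "'a pair_pre_digraph \<Rightarrow> bool" where
  "unicyclic G \<longleftrightarrow>
     pair_graph G \<and> Digraph_Component.connected (with_proj G) \<and> (\<exists>!C. C \<in> cycle_subgraphs G)"

definition c_unicyclic :: "nat \<Rightarrow> 'a pair_pre_digraph \<Rightarrow> bool" where
  "c_unicyclic c G \<longleftrightarrow> unicyclic G \<and> (\<forall>C \<in> cycle_subgraphs G. card (pverts C) = c)"

definition girth :: "'a pair_pre_digraph \<Rightarrow> enat" where
  "girth G = (INF C \<in> cycle_subgraphs G. enat (card (pverts C)))"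

text \<open>Colorings are extensional, so that each map from the vertex set to \<open>nat\<close> is counted once.\<close>

definition proper_colorings :: "'a pair_pre_digraph \<Rightarrow> ('a \<Rightarrow> nat) set" where
  "proper_colorings G = {\<kappa> \<in> pverts G \<rightarrow>\<^sub>E UNIV. \<forall>(u, v) \<in> parcs G. \<kappa> u \<noteq> \<kappa> v}"

definition indet :: "nat \<Rightarrow> (nat \<Rightarrow>\<^sub>0 nat) \<Rightarrow>\<^sub>0 int" where
  "indet i = Poly_Mapping.single (Poly_Mapping.single i 1) 1"

text \<open>
  A formal power series in the commuting variables \<open>indet 0\<close>, \<open>indet 1\<close>, \<open>\<dots>\<close> is given by its
  coefficient at each exponent vector. The infinite sum over colorings is taken coefficientwise;
  only finitely many colorings contribute to each coefficient.
\<close>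

type_synonym power_series = "(nat \<Rightarrow>\<^sub>0 nat) \<Rightarrow> int"

definition coloring_monomial ::
    "'a pair_pre_digraph \<Rightarrow> ('a \<Rightarrow> nat) \<Rightarrow> (nat \<Rightarrow>\<^sub>0 nat) \<Rightarrow>\<^sub>0 int" where
  "coloring_monomial G \<kappa> = (\<Prod>v \<in> pverts G. indet (\<kappa> v))"

definition chromatic_symmetric_function :: "'a pair_pre_digraph \<Rightarrow> power_series" where
  "chromatic_symmetric_function G = (\<lambda>m.
     \<Sum>\<kappa> | \<kappa> \<in> proper_colorings G \<and> Poly_Mapping.lookup (coloring_monomial G \<kappa>) m \<noteq> 0.
       Poly_Mapping.lookup (coloring_monomial G \<kappa>) m)"

lemma coloring_monomial_eq_single:
  "coloring_monomial G \<kappa> =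
     Poly_Mapping.single (\<Sum>v \<in> pverts G. Poly_Mapping.single (\<kappa> v) 1) 1"
proof -
  have "(\<Prod>v \<in> A. indet (\<kappa> v)) = Poly_Mapping.single (\<Sum>v \<in> A. Poly_Mapping.single (\<kappa> v) 1) 1"
    for A :: "'a set"
    by (induction A rule: infinite_finite_induct)
      (simp_all add: indet_def mult_single flip: single_one)
  then show ?thesis by (simp add: coloring_monomial_def)
qed

lemma finite_contributing_colorings:
  assumes "pair_graph G"
  shows "finite {\<kappa> \<in> proper_colorings G. Poly_Mapping.lookup (coloring_monomial G \<kappa>) m \<noteq> 0}"
proof (rule finite_subset)
  from assms have fin: "finite (pverts G)"
    by (simp add: pair_graph.axioms pair_digraph.axioms pair_fin_digraph.pair_finite_verts)
  show "finite (pverts G \<rightarrow>\<^sub>E Poly_Mapping.keys m)"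
    using fin by (intro finite_PiE) simp_all
  show "{\<kappa> \<in> proper_colorings G. Poly_Mapping.lookup (coloring_monomial G \<kappa>) m \<noteq> 0}
          \<subseteq> pverts G \<rightarrow>\<^sub>E Poly_Mapping.keys m"
  proof clarify
    fix \<kappa> assume k: "\<kappa> \<in> proper_colorings G"
      and nz: "Poly_Mapping.lookup (coloring_monomial G \<kappa>) m \<noteq> 0"
    have m: "m = (\<Sum>v \<in> pverts G. Poly_Mapping.single (\<kappa> v) 1)"
      using nz by (auto simp: coloring_monomial_eq_single lookup_single when_def split: if_splits)
    have "\<kappa> v \<in> Poly_Mapping.keys m" if "v \<in> pverts G" for v
      using that fin by (auto simp: m in_keys_iff lookup_sum lookup_single when_def)
    with k show "\<kappa> \<in> pverts G \<rightarrow>\<^sub>E Poly_Mapping.keys m"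
      by (auto simp: proper_colorings_def PiE_iff)
  qed
qed

end

theory Submission
  imports Defs "HOL-Library.Function_Algebras"
begin

text \<open>
  A coloring of a graph with a pendant vertex restricts to a coloring of the rest, so pendant trees
  can be absorbed into weights on the cycle. Moving such a weight between adjacent cycle vertices
  \<open>b\<close>, \<open>c\<close> changes the weighted coloring sum by the same amount as in the graph without the edge
  \<open>bc\<close>, which is a path. For \<open>c \<ge> 4\<close> let \<open>m = c - 2\<close>, let \<open>o\<close> be a vertex and \<open>Q\<close> a vertex with a
  leaf. Around the cycle \<open>o, o, Q\<^sub>1, \<dots>, Q\<^sub>m\<close>, the graph \<open>G\<close> has a path of \<open>m\<close> further \<open>Q\<close>s at the
  second \<open>o\<close> and one \<open>Q\<close> at \<open>Q\<^sub>1\<close>, and \<open>H\<close> has the path at \<open>Q\<^sub>m\<close> and the \<open>Q\<close> at the second \<open>o\<close>. Three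
  moves lead from \<open>G\<close> to \<open>H\<close>, and the six resulting tree sums cancel because a chain of \<open>Q\<close>s acts as
  a self-adjoint operator and because \<open>o\<close> with a pendant \<open>o\<close> is again \<open>Q\<close>. For \<open>c = 3\<close> the two graphs
  would be isomorphic; there the triangle with a leaf at each vertex and the triangle with a leaf
  and a pendant \<open>Q\<close> at one vertex serve instead.
\<close>

section \<open>Sums over trees as functions of the root color\<close>

declare times_fun_apply [simp del]

locale color_weights =
  fixes K :: "'k set" and x :: "'k \<Rightarrow> 'r::comm_ring_1"
begin

text \<open>
  A function on \<open>K\<close> stands for a rooted tree: its value at \<open>i\<close> is the sum over the proper colorings
  giving the root color \<open>i\<close>. Then \<open>others f\<close> is the factor that a subtree \<open>f\<close> contributes to its
  parent, \<open>q\<close> is a vertex with a leaf, \<open>hang k\<close> is the factor contributed by a path of \<open>k\<close> copies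
  of \<open>q\<close>, and \<open>extend k f\<close> is such a path with \<open>f\<close> at its far end.
\<close>

definition total :: "('k \<Rightarrow> 'r) \<Rightarrow> 'r" where
  "total f = sum f K"

definition others :: "('k \<Rightarrow> 'r) \<Rightarrow> 'k \<Rightarrow> 'r" where
  "others f = (\<lambda>i. total f - f i)"

definition q :: "'k \<Rightarrow> 'r" where
  "q = x * others x"

primrec hang :: "nat \<Rightarrow> 'k \<Rightarrow> 'r" where
  "hang 0 = 1"
| "hang (Suc k) = others (q * hang k)"

primrec extend :: "nat \<Rightarrow> ('k \<Rightarrow> 'r) \<Rightarrow> 'k \<Rightarrow> 'r" where
  "extend 0 f = f"
| "extend (Suc k) f = q * others (extend k f)"

lemma extend_Suc_right: "extend (Suc k) f = extend k (q * others f)"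
  by (induction k) simp_all

lemma total_times_others: "total (f * others g) = total f * total g - total (f * g)"
  by (simp add: total_def others_def times_fun_apply right_diff_distrib sum_subtractf sum_distrib_right)

text \<open>The right side of \<open>total_times_others\<close> is symmetric in \<open>f\<close> and
  \<open>g\<close>: two trees joined by an edge may be rooted at either end. So
  \<open>others\<close> is self-adjoint for the form \<open>total (f * g)\<close>.\<close>

lemma total_times_others_commute: "total (f * others g) = total (g * others f)"
  unfolding total_times_others by (simp add: mult.commute)

text \<open>Each use of self-adjointness moves the root one vertex along the chain, taking a
  \<open>q\<close> off \<open>extend\<close> and adding it to \<open>hang\<close>.\<close>

lemma total_extend_times_hang: "total (extend j f * hang k) = total (f * hang (j + k))"
proof (induction j arbitrary: k)
  case (Suc j)
  have "total (extend (Suc j) f * hang k) = total ((q * hang k) * others (extend j f))"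
    by (simp add: mult_ac)
  also have "\<dots> = total (extend j f * hang (Suc k))"
    by (simp add: total_times_others_commute[of "q * hang k"])
  also have "\<dots> = total (f * hang (Suc j + k))"
    using Suc[of "Suc k"] by simp
  finally show ?case .
qed simp

text \<open>The operator sending \<open>g\<close> to \<open>others (extend m g)\<close> alternates
  \<open>others\<close> with multiplication by \<open>q\<close> and reads the same in both
  directions, so it inherits self-adjointness.\<close>

lemma total_times_others_extend_commute:
  "total (f * others (extend m g)) = total (g * others (extend m f))"
proof (induction m arbitrary: f)
  case 0
  then show ?case by (simp add: total_times_others_commute)
next
  case (Suc m)
  have "total (f * others (extend (Suc m) g)) = total ((q * others (extend m g)) * others f)"
    by (simp add: total_times_others_commute[of f])
  also have "\<dots> = total ((q * others f) * others (extend m g))"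
    by (simp add: mult_ac)
  also have "\<dots> = total (g * others (extend m (q * others f)))"
    by (rule Suc)
  finally show ?case
    by (simp only: extend_Suc_right)
qed

text \<open>Both sides are one path of \<open>i + j + 1\<close> copies of \<open>q\<close>;
  self-adjointness shifts the root from an interior vertex to an end.\<close>

lemma total_q_hang_hang: "total (q * hang i * hang j) = total (q * hang (i + j))"
proof (induction i arbitrary: j)
  case (Suc i)
  have "total (q * hang (Suc i) * hang j) = total ((q * hang j) * others (q * hang i))"
    by (simp add: mult_ac)
  also have "\<dots> = total ((q * hang i) * hang (Suc j))"
    by (simp add: total_times_others_commute[of "q * hang j"])
  also have "\<dots> = total (q * hang (Suc i + j))"
    using Suc[of "Suc j"] by simp
  finally show ?case .
qed simp

text \<open>
  Move \<open>w\<close> along the chain link by link: by \<open>total_times_others\<close> the sum over a tree is the product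
  over the two sides of a link minus a term that does not depend on the side carrying \<open>w\<close>.
\<close>

lemma total_move_along_extend:
  "total (f * w * others (extend m g)) - total (g * w * others (extend m f)) =
     (\<Sum>j\<le>m. total (extend j f * w) * total (extend (m - j) g)
           - total (extend j f) * total (extend (m - j) g * w))"
proof (induction m arbitrary: f)
  case 0
  show ?case
    using total_times_others[of "f * w" g] total_times_others[of "g * w" f]
    by (simp add: mult_ac)
next
  case (Suc m)
  let ?h = "q * others f"
  let ?S = "\<Sum>j\<le>m. total (extend j ?h * w) * total (extend (m - j) g)
           - total (extend j ?h) * total (extend (m - j) g * w)"
  let ?T = "total (f * w) * total (extend (Suc m) g) - total f * total (extend (Suc m) g * w)"
  have h: "extend m ?h = extend (Suc m) f"
    by (rule extend_Suc_right[symmetric])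
  \<comment> \<open>\<open>w\<close> crosses the first link, which yields the summand for
    \<open>j = 0\<close>; then \<open>f\<close> is absorbed into the next vertex as
    \<open>?h\<close>, and the rest is the induction hypothesis.\<close>
  have link: "total (f * w * others (extend (Suc m) g)) - total (w * extend (Suc m) g * others f) = ?T"
    using total_times_others[of "f * w" "extend (Suc m) g"]
      total_times_others[of "w * extend (Suc m) g" f]
    by (simp del: extend.simps add: mult_ac)
  have "w * extend (Suc m) g * others f = ?h * w * others (extend m g)"
    by (simp add: mult_ac)
  then have "total (f * w * others (extend (Suc m) g)) - total (g * w * others (extend (Suc m) f)) =
      (total (f * w * others (extend (Suc m) g)) - total (w * extend (Suc m) g * others f))
      + (total (?h * w * others (extend m g)) - total (g * w * others (extend m ?h)))"
    by (simp only: h) simp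
  also have "\<dots> = ?T + ?S"
    unfolding link Suc[of ?h] ..
  also have "\<dots> = (\<Sum>j\<le>Suc m. total (extend j f * w) * total (extend (Suc m - j) g)
           - total (extend j f) * total (extend (Suc m - j) g * w))"
    unfolding sum.atMost_Suc_shift
    by (simp del: extend.simps(2) add: extend_Suc_right[symmetric])
  finally show ?case .
qed

section \<open>Identities for paths hanging from a single vertex\<close>

text \<open>Splitting each sum at the link between \<open>x\<close> and the path lengthened by
  \<open>Suc\<close> subtracts the same term \<open>total (x * q * hang i * hang j)\<close>, which
  cancels.\<close>

lemma total_hang_swap:
  "total (x * hang i * hang (Suc j)) - total (x * hang (Suc i) * hang j) =
     total (x * hang i) * total (q * hang j) - total (x * hang j) * total (q * hang i)"
proof -
  have "total (x * hang (Suc i) * hang j) = total (x * hang j * others (q * hang i))"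
    by (simp add: mult_ac)
  then show ?thesis
    using total_times_others[of "x * hang i" "q * hang j"]
      total_times_others[of "x * hang j" "q * hang i"]
    by (simp add: mult_ac)
qed

text \<open>\<open>total_move_along_extend\<close> turns the left side into a sum over the links of
  the chain; \<open>total_hang_swap\<close> rewrites its summands as differences that
  telescope.\<close>

lemma total_move_hang:
  "total (x * hang m * others (extend m (x * hang 1)))
     - total (x * hang 1 * hang m * others (extend m x)) =
   total (x * hang m) * total (x * hang (Suc m)) - total x * total (x * hang (Suc m) * hang m)"
proof -
  define a where "a k = total (x * hang 1 * hang k)" for k
  define b where "b k = total (x * hang k)" for k
  define k where "k j = total (q * hang j)" for j
  define c where "c i j = total (x * hang i * hang j)" for i j
  have swap: "c i (Suc j) - c (Suc i) j = b i * k j - b j * k i" for i j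
    unfolding b_def c_def k_def by (rule total_hang_swap)
  have c0: "c 0 j = b j" for j by (simp add: b_def c_def)
  have a: "a j = b (Suc j) - b 0 * k j + b j * k 0" for j
  proof -
    have "a j = c 1 j" by (simp add: a_def c_def)
    then show ?thesis
      using swap[of 0 j] c0[of "Suc j"] by (simp add: algebra_simps)
  qed
  have "total (x * hang m * others (extend m (x * hang 1)))
     - total (x * hang 1 * hang m * others (extend m x)) =
     (\<Sum>j\<le>m. b (j + m) * a (m - j) - b j * a (m - j + m))"
    unfolding total_move_along_extend a_def b_def
    using total_extend_times_hang[where k = 0] by (simp add: total_extend_times_hang)
  also have "\<dots> = (\<Sum>j\<le>m. b (j + m) * a (m - j)) - (\<Sum>j\<le>m. b j * a (m - j + m))"
    by (rule sum_subtractf)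
  also have "(\<Sum>j\<le>m. b (j + m) * a (m - j)) = (\<Sum>j\<le>m. b (m - j + m) * a j)"
    unfolding atMost_atLeast0 by (subst sum.atLeastAtMost_rev) simp
  \<comment> \<open>After inserting \<open>a\<close>, the terms with \<open>k 0\<close> cancel by
    symmetry and those with \<open>b 0\<close> combine through \<open>swap\<close>. What remains are
    consecutive differences of \<open>b j * b (Suc (2 * m) - j)\<close> and of
    \<open>c j (Suc (2 * m) - j)\<close>.\<close>
  also have "\<dots> - (\<Sum>j\<le>m. b j * a (m - j + m)) =
      (\<Sum>j\<le>m. (b (Suc j) * b (Suc (2 * m) - Suc j) - b j * b (Suc (2 * m) - j))
        + b 0 * (c j (Suc (2 * m) - j) - c (Suc j) (Suc (2 * m) - Suc j)))"
    unfolding sum_subtractf[symmetric]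
  proof (rule sum.cong)
    fix j assume "j \<in> {..m}"
    then have "m - j + m = 2 * m - j" "Suc (2 * m) - j = Suc (2 * m - j)"
      "Suc (2 * m) - Suc j = 2 * m - j" by auto
    then show "b (m - j + m) * a j - b j * a (m - j + m) =
      (b (Suc j) * b (Suc (2 * m) - Suc j) - b j * b (Suc (2 * m) - j))
        + b 0 * (c j (Suc (2 * m) - j) - c (Suc j) (Suc (2 * m) - Suc j))"
      by (simp add: a swap) (simp add: algebra_simps)
  qed simp
  also have "\<dots> = (\<Sum>j\<le>m. b (Suc j) * b (Suc (2 * m) - Suc j) - b j * b (Suc (2 * m) - j))
        - b 0 * (\<Sum>j\<le>m. c (Suc j) (Suc (2 * m) - Suc j) - c j (Suc (2 * m) - j))"
    unfolding sum.distrib sum_distrib_left sum_subtractf[symmetric] sum_negf[symmetric]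
    by (simp add: algebra_simps sum_subtractf sum.distrib)
  also have "(\<Sum>j\<le>m. b (Suc j) * b (Suc (2 * m) - Suc j) - b j * b (Suc (2 * m) - j)) =
      b (Suc m) * b m - b 0 * b (Suc (2 * m))"
    using sum_lessThan_telescope[of "\<lambda>j. b j * b (Suc (2 * m) - j)" "Suc m"]
    by (simp add: lessThan_Suc_atMost mult_2)
  also have "(\<Sum>j\<le>m. c (Suc j) (Suc (2 * m) - Suc j) - c j (Suc (2 * m) - j)) =
      c (Suc m) m - b (Suc (2 * m))"
    using sum_lessThan_telescope[of "\<lambda>j. c j (Suc (2 * m) - j)" "Suc m"]
    by (simp add: lessThan_Suc_atMost mult_2 c0)
  finally show ?thesis
    by (simp add: b_def c_def algebra_simps)
qed

text \<open>A path of \<open>2 * m + 2\<close> copies of \<open>q\<close> is rooted near its middle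
  and the root split as \<open>x * others x\<close>; the subtracted term with \<open>x * x\<close>
  is then the same as for the left side.\<close>

lemma total_x_hang_others:
  "total (x * hang m * others (x * hang (Suc m))) =
     total (q * hang 1 * hang (2 * m))
     + (total (x * hang m) * total (x * hang (Suc m)) - total x * total (x * hang (Suc m) * hang m))"
proof -
  have "total (q * hang 1 * hang (2 * m)) = total (q * hang m * hang (Suc m))"
    by (simp only: total_q_hang_hang) (simp add: mult_2)
  also have "\<dots> = total ((x * hang (Suc m) * hang m) * others x)"
    by (simp add: q_def mult_ac)
  also have "\<dots> = total x * total (x * hang (Suc m) * hang m)
      - total (x * x * hang (Suc m) * hang m)"
    by (simp only: total_times_others) (simp add: mult_ac)
  finally show ?thesis
    unfolding total_times_others by (simp only: mult_ac) (simp add: mult_ac)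
qed

text \<open>The bracket in \<open>total_x_hang_others\<close> is the right side of
  \<open>total_move_hang\<close>. The sum of the three moves around the cycle will reduce to this
  relation.\<close>

lemma tree_relation:
  "total (x * hang m * others (x * hang (Suc m)))
     + total (x * hang 1 * hang m * others (extend m x)) =
   total (x * hang m * others (extend m (x * hang 1))) + total (q * hang 1 * hang (2 * m))"
  by (simp only: total_x_hang_others total_move_hang[symmetric]) simp

end

section \<open>Weighted sums over proper colorings\<close>

definition colorings :: "'k set \<Rightarrow> 'a set \<Rightarrow> ('a \<times> 'a) set \<Rightarrow> ('a \<Rightarrow> 'k) set" where
  "colorings K V E = {\<kappa> \<in> V \<rightarrow>\<^sub>E K. \<forall>(u, v) \<in> E. \<kappa> u \<noteq> \<kappa> v}"

lemma finite_colorings: "finite V \<Longrightarrow> finite K \<Longrightarrow> finite (colorings K V E)"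
  by (rule finite_subset[of _ "V \<rightarrow>\<^sub>E K"]) (auto simp: colorings_def intro: finite_PiE)

text \<open>\<open>S\<close> is the neighborhood of the new vertex: one vertex when a leaf is added,
  two adjacent vertices when a triangle is closed.\<close>

lemma colorings_insert:
  assumes "v \<notin> V" "E \<subseteq> V \<times> V" "S \<subseteq> V"
  shows "colorings K (insert v V) (E \<union> {v} \<times> S \<union> S \<times> {v}) =
    (\<lambda>(\<kappa>, i). \<kappa>(v := i)) ` (SIGMA \<kappa> : colorings K V E. K - \<kappa> ` S)" (is "?L = ?R")
proof
  show "?L \<subseteq> ?R"
  proof
    fix \<kappa> assume \<kappa>: "\<kappa> \<in> ?L"
    let ?\<mu> = "\<kappa>(v := undefined)"
    have eq: "?\<mu> u = \<kappa> u" if "u \<in> V" for u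
      using that assms(1) by auto
    have "?\<mu> \<in> V \<rightarrow>\<^sub>E K"
      using \<kappa> assms(1) by (auto simp: colorings_def PiE_iff extensional_def)
    moreover have "\<forall>(u, u') \<in> E. ?\<mu> u \<noteq> ?\<mu> u'"
      using \<kappa> assms(2) eq by (auto simp: colorings_def subset_iff ball_Un simp del: fun_upd_apply)
    ultimately have "?\<mu> \<in> colorings K V E"
      by (simp add: colorings_def)
    moreover have "?\<mu> ` S = \<kappa> ` S"
      using assms(1,3) by (intro image_cong) auto
    then have "\<kappa> v \<in> K - ?\<mu> ` S"
      using \<kappa> by (auto simp: colorings_def PiE_iff)
    ultimately show "\<kappa> \<in> ?R"
      by (intro image_eqI[where x = "(?\<mu>, \<kappa> v)"]) auto
  qed
  show "?R \<subseteq> ?L"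
  proof clarify
    fix \<kappa> i assume \<kappa>: "\<kappa> \<in> colorings K V E" and i: "i \<in> K" "i \<notin> \<kappa> ` S"
    have eq: "(\<kappa>(v := i)) u = \<kappa> u" if "u \<in> V" for u
      using that assms(1) by auto
    have "\<kappa>(v := i) \<in> insert v V \<rightarrow>\<^sub>E K"
      using \<kappa> i by (auto simp: colorings_def PiE_iff extensional_def)
    moreover have "\<forall>(u, u') \<in> E. (\<kappa>(v := i)) u \<noteq> (\<kappa>(v := i)) u'"
      using \<kappa> assms(2) eq by (auto simp: colorings_def subset_iff ball_Un simp del: fun_upd_apply)
    moreover have "(\<kappa>(v := i)) s \<noteq> i" if "s \<in> S" for s
      using that i assms(3) eq[of s] by auto
    ultimately show "\<kappa>(v := i) \<in> ?L"
      by (fastforce simp: colorings_def)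
  qed
qed

lemma inj_on_fun_upd_colorings:
  assumes "v \<notin> V"
  shows "inj_on (\<lambda>(\<kappa>, i). \<kappa>(v := i)) (SIGMA \<kappa> : colorings K V E. I \<kappa>)"
proof (rule inj_onI, clarify)
  fix \<kappa> i \<mu> j
  assume *: "\<kappa> \<in> colorings K V E" "\<mu> \<in> colorings K V E" "\<kappa>(v := i) = \<mu>(v := j)"
  then have "\<kappa> v = \<mu> v"
    using assms by (auto simp: colorings_def PiE_iff extensional_def)
  with * show "\<kappa> = \<mu> \<and> i = j"
    by (auto simp: fun_eq_iff fun_upd_def split: if_splits)
qed

definition coloring_sum ::
    "'k set \<Rightarrow> 'a set \<Rightarrow> ('a \<times> 'a) set \<Rightarrow> ('a \<Rightarrow> 'k \<Rightarrow> 'r::comm_ring_1) \<Rightarrow> 'r" where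
  "coloring_sum K V E w = (\<Sum>\<kappa> \<in> colorings K V E. \<Prod>v \<in> V. w v (\<kappa> v))"

lemma coloring_sum_cong:
  "(\<And>v. v \<in> V \<Longrightarrow> w v = w' v) \<Longrightarrow> coloring_sum K V E w = coloring_sum K V E w'"
  by (simp add: coloring_sum_def)

lemma coloring_sum_insert:
  assumes "finite V" "finite K" "v \<notin> V" "E \<subseteq> V \<times> V" "S \<subseteq> V"
  shows "coloring_sum K (insert v V) (E \<union> {v} \<times> S \<union> S \<times> {v}) w =
    (\<Sum>\<kappa> \<in> colorings K V E. (\<Prod>u \<in> V. w u (\<kappa> u)) * sum (w v) (K - \<kappa> ` S))"
proof -
  have fin: "finite (colorings K V E)"
    using assms(1,2) by (rule finite_colorings)
  have "coloring_sum K (insert v V) (E \<union> {v} \<times> S \<union> S \<times> {v}) w =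
      (\<Sum>(\<kappa>, i) \<in> (SIGMA \<kappa> : colorings K V E. K - \<kappa> ` S). \<Prod>u \<in> insert v V. w u ((\<kappa>(v := i)) u))"
    unfolding coloring_sum_def colorings_insert[OF assms(3-5)]
    by (subst sum.reindex[OF inj_on_fun_upd_colorings[OF assms(3)]]) (simp add: case_prod_unfold)
  also have "\<dots> = (\<Sum>\<kappa> \<in> colorings K V E. \<Sum>i \<in> K - \<kappa> ` S. \<Prod>u \<in> insert v V. w u ((\<kappa>(v := i)) u))"
    using fin assms(2) by (subst sum.Sigma) auto
  also have "\<dots> = (\<Sum>\<kappa> \<in> colorings K V E. \<Sum>i \<in> K - \<kappa> ` S. (\<Prod>u \<in> V. w u (\<kappa> u)) * w v i)"
  proof (intro sum.cong refl)
    fix \<kappa> i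
    have "(\<Prod>u \<in> V. w u ((\<kappa>(v := i)) u)) = (\<Prod>u \<in> V. w u (\<kappa> u))"
      using assms(3) by (intro prod.cong) auto
    then show "(\<Prod>u \<in> insert v V. w u ((\<kappa>(v := i)) u)) = (\<Prod>u \<in> V. w u (\<kappa> u)) * w v i"
      using assms(1,3) by (simp add: mult.commute)
  qed
  finally show ?thesis by (simp add: sum_distrib_left)
qed

lemma prod_fun_upd_times:
  assumes "finite V" "b \<in> V"
  shows "(\<Prod>v \<in> V. (w(b := w b * g)) v (\<kappa> v)) = (\<Prod>v \<in> V. w v (\<kappa> v)) * g (\<kappa> b)"
proof -
  have "(\<Prod>v \<in> V - {b}. (w(b := w b * g)) v (\<kappa> v)) = (\<Prod>v \<in> V - {b}. w v (\<kappa> v))"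
    by (intro prod.cong) auto
  then show ?thesis
    using assms by (simp add: prod.remove[of V b] times_fun_apply mult_ac)
qed

text \<open>The leaf may take any color but that of \<open>s\<close>, so summing over it gives
  \<open>others (w v)\<close> at the color of \<open>s\<close>. This is how pendant trees are
  absorbed into weights.\<close>

lemma coloring_sum_pendant:
  assumes "finite V" "finite K" "v \<notin> V" "s \<in> V" "E \<subseteq> V \<times> V"
  shows "coloring_sum K (insert v V) (E \<union> {(v, s), (s, v)}) w =
    coloring_sum K V E (w(s := w s * color_weights.others K (w v)))"
proof -
  have E: "E \<union> {(v, s), (s, v)} = E \<union> {v} \<times> {s} \<union> {s} \<times> {v}" by auto
  show ?thesis
    unfolding E
  proof (subst coloring_sum_insert)
    show "(\<Sum>\<kappa> \<in> colorings K V E. (\<Prod>u \<in> V. w u (\<kappa> u)) * sum (w v) (K - \<kappa> ` {s})) =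
      coloring_sum K V E (w(s := w s * color_weights.others K (w v)))"
      unfolding coloring_sum_def prod_fun_upd_times[OF assms(1,4)]
    proof (rule sum.cong)
      fix \<kappa> assume "\<kappa> \<in> colorings K V E"
      then have "\<kappa> s \<in> K" using assms(4) by (auto simp: colorings_def)
      then show "(\<Prod>u \<in> V. w u (\<kappa> u)) * sum (w v) (K - \<kappa> ` {s}) =
          (\<Prod>v \<in> V. w v (\<kappa> v)) * color_weights.others K (w v) (\<kappa> s)"
        using assms(2)
        by (simp add: color_weights.others_def color_weights.total_def sum_diff)
    qed simp
  qed (use assms in auto)
qed

text \<open>
  For the difference on the left, the colorings giving \<open>b\<close> and \<open>c\<close> the same color contribute
  nothing, so the edge between them is irrelevant.
\<close>

lemma coloring_sum_move_factor:
  assumes "finite V" "finite K" "b \<in> V" "c \<in> V"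
  shows "coloring_sum K V (E \<union> {(b, c), (c, b)}) (w(b := w b * g))
       - coloring_sum K V (E \<union> {(b, c), (c, b)}) (w(c := w c * g)) =
    coloring_sum K V E (w(b := w b * g)) - coloring_sum K V E (w(c := w c * g))"
proof -
  let ?P = "\<lambda>\<kappa>. \<Prod>v \<in> V. w v (\<kappa> v)"
  have fin: "finite (colorings K V E)"
    using assms(1,2) by (rule finite_colorings)
  have "(\<Sum>\<kappa> \<in> colorings K V (E \<union> {(b, c), (c, b)}). ?P \<kappa> * (g (\<kappa> b) - g (\<kappa> c))) =
      (\<Sum>\<kappa> \<in> colorings K V E. ?P \<kappa> * (g (\<kappa> b) - g (\<kappa> c)))"
  proof (rule sum.mono_neutral_left[OF fin])
    show "colorings K V (E \<union> {(b, c), (c, b)}) \<subseteq> colorings K V E"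
      by (auto simp: colorings_def)
    show "\<forall>\<kappa> \<in> colorings K V E - colorings K V (E \<union> {(b, c), (c, b)}).
        ?P \<kappa> * (g (\<kappa> b) - g (\<kappa> c)) = 0"
      by (auto simp: colorings_def)
  qed
  then show ?thesis
    using assms
    by (simp only: coloring_sum_def prod_fun_upd_times sum_subtractf[symmetric] right_diff_distrib)
qed

section \<open>Paths and their coloring sums\<close>

fun chain :: "'a list \<Rightarrow> ('a \<times> 'a) set" where
  "chain (u # v # vs) = chain (v # vs) \<union> {(u, v), (v, u)}"
| "chain _ = {}"

lemma chain_subset: "chain vs \<subseteq> set vs \<times> set vs"
  by (induction vs rule: chain.induct) auto

lemma chain_snoc:
  "vs \<noteq> [] \<Longrightarrow> chain (vs @ [v]) = chain vs \<union> {(last vs, v), (v, last vs)}"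
  by (induction vs rule: chain.induct) auto

lemma chain_upt:
  "(u, v) \<in> chain [i..<j] \<longleftrightarrow> i \<le> u \<and> u < j \<and> i \<le> v \<and> v < j \<and> (v = Suc u \<or> u = Suc v)"
proof (induction j)
  case (Suc j)
  show ?case
  proof (cases "i < j")
    case True
    then have "chain [i..<Suc j] = chain [i..<j] \<union> {(j - 1, j), (j, j - 1)}"
      by (simp add: chain_snoc)
    then have "(u, v) \<in> chain [i..<Suc j] \<longleftrightarrow>
        (u, v) \<in> chain [i..<j] \<or> u = j - 1 \<and> v = j \<or> u = j \<and> v = j - 1"
      by (auto simp del: upt_Suc)
    then show ?thesis
      unfolding Suc.IH using True by (cases "u = j"; cases "v = j") (auto simp: less_Suc_eq)
  next
    case False
    then have "chain [i..<Suc j] = {}"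
      by (cases "i = j") simp_all
    then show ?thesis
      using False by (cases "i = j") auto
  qed
qed simp

context color_weights
begin

fun path_sum :: "('k \<Rightarrow> 'r) list \<Rightarrow> 'r" where
  "path_sum (f # g # fs) = path_sum (g * others f # fs)"
| "path_sum [f] = total f"
| "path_sum [] = 1"

lemma coloring_sum_chain:
  assumes "finite K" "distinct vs" "vs \<noteq> []"
  shows "coloring_sum K (set vs) (chain vs) w = path_sum (map w vs)"
  using assms(2,3)
proof (induction vs arbitrary: w rule: chain.induct)
  case (1 u v vs)
  have "coloring_sum K (set (u # v # vs)) (chain (u # v # vs)) w =
      coloring_sum K (insert u (set (v # vs))) (chain (v # vs) \<union> {(u, v), (v, u)}) w"
    by simp
  also have "\<dots> = coloring_sum K (set (v # vs)) (chain (v # vs)) (w(v := w v * others (w u)))"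
    using 1 assms chain_subset[of "v # vs"] by (intro coloring_sum_pendant) auto
  also have "\<dots> = path_sum (map (w(v := w v * others (w u))) (v # vs))"
    using 1 by simp
  also have "map (w(v := w v * others (w u))) (v # vs) = w v * others (w u) # map w vs"
    using 1(2) by auto
  finally show ?case by simp
next
  case ("2_2" v)
  have "colorings K {v} {} = (\<lambda>i. (\<lambda>_. undefined)(v := i)) ` K"
    by (auto simp: colorings_def PiE_singleton PiE_iff extensional_def image_iff fun_eq_iff)
  moreover have "inj_on (\<lambda>i. (\<lambda>_. undefined)(v := i)) K"
    by (rule inj_onI) (metis fun_upd_same)
  ultimately show ?case
    by (simp add: coloring_sum_def total_def sum.reindex)
qed simp

lemma path_sum_q:
  "path_sum (f # replicate m q @ g # fs) = path_sum (g * others (extend m f) # fs)"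
proof (induction m arbitrary: f)
  case (Suc m)
  show ?case
    using Suc[of "q * others f"] by (simp flip: extend_Suc_right)
qed simp

end

section \<open>Unicyclic graphs with parent functions\<close>

definition cycle_arcs :: "nat \<Rightarrow> nat rel" where
  "cycle_arcs c = chain [0..<c] \<union> {(0, c - 1), (c - 1, 0)}"

text \<open>Together with \<open>p v < v\<close>, as assumed below, this numbering makes the last
  vertex beyond the cycle a leaf, so the trees can be stripped off from the top.\<close>

definition unicyclic_arcs :: "nat \<Rightarrow> (nat \<Rightarrow> nat) \<Rightarrow> nat \<Rightarrow> nat rel" where
  "unicyclic_arcs c p n = cycle_arcs c \<union> (\<Union>v \<in> {c..<n}. {(v, p v), (p v, v)})"

lemma cycle_arcs_iff:
  "c \<ge> 3 \<Longrightarrow> (u, v) \<in> cycle_arcs c \<longleftrightarrow>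
    u < c \<and> v < c \<and> (v = Suc u \<or> u = Suc v \<or> u = 0 \<and> v = c - 1 \<or> u = c - 1 \<and> v = 0)"
  unfolding cycle_arcs_def Un_iff chain_upt by auto

lemma unicyclic_arcs_same [simp]: "unicyclic_arcs c p c = cycle_arcs c"
  by (simp add: unicyclic_arcs_def)

lemma unicyclic_arcs_Suc:
  "c \<le> n \<Longrightarrow> unicyclic_arcs c p (Suc n) = unicyclic_arcs c p n \<union> {(n, p n), (p n, n)}"
  by (auto simp: unicyclic_arcs_def atLeastLessThanSuc)

lemma cycle_arcs_subset: "c > 0 \<Longrightarrow> cycle_arcs c \<subseteq> {..<c} \<times> {..<c}"
  using chain_subset[of "[0..<c]"] by (auto simp: cycle_arcs_def)

lemma unicyclic_arcs_subset:
  assumes "0 < c" "c \<le> n" "\<And>v. c \<le> v \<Longrightarrow> v < n \<Longrightarrow> p v < v"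
  shows "unicyclic_arcs c p n \<subseteq> {..<n} \<times> {..<n}"
  using cycle_arcs_subset[of c] assms by (fastforce simp: unicyclic_arcs_def)

context color_weights
begin

lemma coloring_sum_unicyclic_Suc:
  assumes "finite K" "0 < c" "c \<le> n" "\<And>v. c \<le> v \<Longrightarrow> v \<le> n \<Longrightarrow> p v < v"
  shows "coloring_sum K {..<Suc n} (unicyclic_arcs c p (Suc n)) w =
    coloring_sum K {..<n} (unicyclic_arcs c p n) (w(p n := w (p n) * others (w n)))"
  unfolding unicyclic_arcs_Suc[OF assms(3)] lessThan_Suc
  using assms unicyclic_arcs_subset[of c n p] by (intro coloring_sum_pendant) auto

text \<open>The vertices \<open>s\<close>, \<open>s + 2\<close>, up to \<open>s + 2 * k\<close> form
  the path, each with the next number as its leaf. The induction strips the far end, whose weight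
  \<open>x * hang j\<close> records the \<open>j\<close> copies of \<open>q\<close> already absorbed
  there.\<close>

lemma coloring_sum_hang:
  assumes "finite K" "0 < c" "c \<le> s" "a < s" and less: "\<And>v. c \<le> v \<Longrightarrow> p v < v"
    and p: "p s = a" "\<And>i. p (s + 2 * i + 1) = s + 2 * i"
      "\<And>i. i < k \<Longrightarrow> p (s + 2 * i + 2) = s + 2 * i"
    and w: "w (s + 2 * k) = x * hang j" "w (s + 2 * k + 1) = x"
      "\<And>v. s \<le> v \<Longrightarrow> v < s + 2 * k \<Longrightarrow> w v = x"
  shows "coloring_sum K {..<s + 2 * k + 2} (unicyclic_arcs c p (s + 2 * k + 2)) w =
    coloring_sum K {..<s} (unicyclic_arcs c p s) (w(a := w a * hang (j + k + 1)))"
  using p(3) w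
proof (induction k arbitrary: w j)
  case 0
  let ?w1 = "w(s := w s * others (w (Suc s)))"
  have "coloring_sum K {..<s + 2 * 0 + 2} (unicyclic_arcs c p (s + 2 * 0 + 2)) w =
      coloring_sum K {..<Suc s} (unicyclic_arcs c p (Suc s)) ?w1"
    using coloring_sum_unicyclic_Suc[of c "Suc s" p w] assms less p(1) p(2)[of 0] by simp
  also have "\<dots> = coloring_sum K {..<s} (unicyclic_arcs c p s) (?w1(a := ?w1 a * others (?w1 s)))"
    using coloring_sum_unicyclic_Suc[of c s p ?w1] assms(1-4) less p(1) by simp
  also have "\<dots> = coloring_sum K {..<s} (unicyclic_arcs c p s) (w(a := w a * hang (j + 0 + 1)))"
    using 0 assms(4) by (intro coloring_sum_cong) (auto simp: q_def mult_ac)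
  finally show ?case .
next
  case (Suc k)
  let ?r = "s + 2 * k"
  let ?w1 = "w(?r + 2 := w (?r + 2) * others (w (?r + 3)))"
  let ?w2 = "?w1(?r := ?w1 ?r * others (?w1 (?r + 2)))"
  have "coloring_sum K {..<s + 2 * Suc k + 2} (unicyclic_arcs c p (s + 2 * Suc k + 2)) w =
      coloring_sum K {..<?r + 3} (unicyclic_arcs c p (?r + 3)) ?w1"
    using coloring_sum_unicyclic_Suc[of c "?r + 3" p w] assms less p(2)[of "Suc k"]
    by (simp add: eval_nat_numeral)
  also have "\<dots> = coloring_sum K {..<?r + 2} (unicyclic_arcs c p (?r + 2)) ?w2"
    using coloring_sum_unicyclic_Suc[of c "?r + 2" p ?w1] assms less Suc.prems(1)[of k]
    by (simp add: eval_nat_numeral)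
  also have "\<dots> = coloring_sum K {..<s} (unicyclic_arcs c p s) (?w2(a := ?w2 a * hang (Suc j + k + 1)))"
  proof (rule Suc.IH)
    show "?w2 ?r = x * hang (Suc j)"
      using Suc.prems by (simp add: q_def mult_ac eval_nat_numeral)
  qed (use Suc.prems in auto)
  also have "\<dots> = coloring_sum K {..<s} (unicyclic_arcs c p s) (w(a := w a * hang (j + Suc k + 1)))"
    using assms(4) by (intro coloring_sum_cong) auto
  finally show ?case .
qed

lemma coloring_sum_leaves:
  assumes "finite K" "0 < c" "2 + k \<le> c" and less: "\<And>v. c \<le> v \<Longrightarrow> p v < v"
    and "\<And>i. i < k \<Longrightarrow> p (c + i) = 2 + i" "\<And>v. c \<le> v \<Longrightarrow> v < c + k \<Longrightarrow> w v = x"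
  shows "coloring_sum K {..<c + k} (unicyclic_arcs c p (c + k)) w =
    coloring_sum K {..<c} (cycle_arcs c) (\<lambda>v. if 2 \<le> v \<and> v < 2 + k then w v * others x else w v)"
  using assms(3,5,6)
proof (induction k arbitrary: w)
  case 0
  have "(\<lambda>v. if 2 \<le> v \<and> v < 2 + 0 then w v * others x else w v) = w" by (rule ext) auto
  then show ?case by simp
next
  case (Suc k)
  have "coloring_sum K {..<c + Suc k} (unicyclic_arcs c p (c + Suc k)) w =
      coloring_sum K {..<c + k} (unicyclic_arcs c p (c + k)) (w(2 + k := w (2 + k) * others x))"
    using coloring_sum_unicyclic_Suc[of c "c + k" p w] assms(1,2) less Suc.prems by simp
  also have "\<dots> = coloring_sum K {..<c} (cycle_arcs c)
      (\<lambda>v. if 2 \<le> v \<and> v < 2 + k then (w(2 + k := w (2 + k) * others x)) v * others x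
        else (w(2 + k := w (2 + k) * others x)) v)"
    using Suc.prems by (intro Suc.IH) auto
  also have "\<dots> = coloring_sum K {..<c} (cycle_arcs c)
      (\<lambda>v. if 2 \<le> v \<and> v < 2 + Suc k then w v * others x else w v)"
    by (intro coloring_sum_cong) auto
  finally show ?case .
qed

end

section \<open>The pair of graphs for cycles of length at least four\<close>

text \<open>
  Vertices \<open>0, \<dots>, m + 1\<close> form the cycle, \<open>m + 2, \<dots>, 2 m + 1\<close> are leaves at \<open>2, \<dots>, m + 1\<close>. The even
  vertices from \<open>2 m + 2\<close> to \<open>4 m\<close> form a path hanging from \<open>a\<close>, and \<open>4 m + 2\<close> hangs from \<open>b\<close>;
  each of them carries the next odd vertex as a leaf.
\<close>

definition parent :: "nat \<Rightarrow> nat \<Rightarrow> nat \<Rightarrow> nat \<Rightarrow> nat" where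
  "parent m a b v =
     (if v < 2 * m + 2 then v - m
      else if v = 2 * m + 2 then a
      else if v = 4 * m + 2 then b
      else if odd v then v - 1 else v - 2)"

context color_weights
begin

definition attach :: "nat \<Rightarrow> nat \<Rightarrow> (nat \<Rightarrow> 'k \<Rightarrow> 'r) \<Rightarrow> nat \<Rightarrow> 'k \<Rightarrow> 'r" where
  "attach a j w = w(a := w a * hang j)"

text \<open>The cycle weights that come from the leaves alone, without the trees at \<open>a\<close>
  and \<open>b\<close>.\<close>

definition base :: "nat \<Rightarrow> 'k \<Rightarrow> 'r" where
  "base v = (if v < 2 then x else q)"

lemma attach_commute: "attach a i (attach b j w) = attach b j (attach a i w)"
  by (auto simp: attach_def mult_ac)

lemma coloring_sum_parent:
  assumes "finite K" "a < m + 2" "b < m + 2" "m \<ge> 1"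
  shows "coloring_sum K {..<4 * m + 4} (unicyclic_arcs (m + 2) (parent m a b) (4 * m + 4)) (\<lambda>_. x) =
    coloring_sum K {..<m + 2} (cycle_arcs (m + 2)) (attach a m (attach b 1 base))"
proof -
  let ?p = "parent m a b"
  let ?arcs = "unicyclic_arcs (m + 2) ?p"
  have less: "?p v < v" if "m + 2 \<le> v" for v
    using that assms by (auto simp: parent_def)
  let ?w1 = "attach b 1 (\<lambda>_. x)"
  let ?w2 = "attach a m ?w1"
  have p: "?p (4 * m + 3) = 4 * m + 2" "?p (4 * m + 2) = b"
    using assms(4) by (simp_all add: parent_def)
  \<comment> \<open>The path of \<open>m\<close> copies of \<open>q\<close> ends at
    \<open>4 * m\<close> with leaf \<open>4 * m + 1\<close>, so \<open>coloring_sum_hang\<close> is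
    applied with \<open>k = m - 1\<close>.\<close>
  have s: "2 * m + 2 + 2 * (m - 1) + 2 = 4 * m + 2" using assms(4) by simp
  have "coloring_sum K {..<4 * m + 4} (?arcs (4 * m + 4)) (\<lambda>_. x) =
      coloring_sum K {..<4 * m + 3} (?arcs (4 * m + 3)) ((\<lambda>_. x)(4 * m + 2 := q))"
    using coloring_sum_unicyclic_Suc[of "m + 2" "4 * m + 3" ?p "\<lambda>_. x", unfolded p] assms less
    by (simp add: eval_nat_numeral q_def)
  also have "\<dots> = coloring_sum K {..<4 * m + 2} (?arcs (4 * m + 2))
      (((\<lambda>_. x)(4 * m + 2 := q))(b := x * hang 1))"
    using coloring_sum_unicyclic_Suc[of "m + 2" "4 * m + 2" ?p "(\<lambda>_. x)(4 * m + 2 := q)", unfolded p]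
      assms less
    by (simp add: eval_nat_numeral)
  also have "\<dots> = coloring_sum K {..<4 * m + 2} (?arcs (4 * m + 2)) ?w1"
    by (intro coloring_sum_cong) (auto simp: attach_def)
  also have "\<dots> = coloring_sum K {..<2 * m + 2} (?arcs (2 * m + 2)) ?w2"
  proof -
    have "?p (2 * m + 2) = a"
      using assms(4) by (simp add: parent_def)
    moreover have "?p (2 * m + 2 + 2 * i + 1) = 2 * m + 2 + 2 * i" for i
    proof -
      have "2 * m + 2 + 2 * i + 1 \<noteq> 4 * m + 2" by presburger
      then show ?thesis by (simp add: parent_def)
    qed
    moreover have "?p (2 * m + 2 + 2 * i + 2) = 2 * m + 2 + 2 * i" if "i < m - 1" for i
    proof -
      have "2 * m + 2 + 2 * i + 2 \<noteq> 4 * m + 2" using that by linarith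
      then show ?thesis by (simp add: parent_def)
    qed
    ultimately show ?thesis
      using coloring_sum_hang[of "m + 2" "2 * m + 2" a ?p "m - 1" ?w1 0] assms less
      unfolding s by (simp add: attach_def)
  qed
  also have "\<dots> = coloring_sum K {..<m + 2 + m} (?arcs (m + 2 + m)) ?w2"
    by (simp add: mult_2 add_ac)
  also have "\<dots> = coloring_sum K {..<m + 2} (cycle_arcs (m + 2))
      (\<lambda>v. if 2 \<le> v \<and> v < 2 + m then ?w2 v * others x else ?w2 v)"
    using assms less by (intro coloring_sum_leaves) (auto simp: parent_def attach_def)
  also have "\<dots> = coloring_sum K {..<m + 2} (cycle_arcs (m + 2)) (attach a m (attach b 1 base))"
    by (intro coloring_sum_cong) (auto simp: attach_def base_def q_def mult_ac)
  finally show ?thesis .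
qed

lemma extend_q: "extend k (q * hang j) = q * hang (k + j)"
  by (induction k) simp_all

lemma others_extend_q: "others (extend k (q * hang j)) = hang (Suc (k + j))"
  by (simp add: extend_q)

lemma map_base [simp]: "2 \<le> i \<Longrightarrow> map base [i..<j] = replicate (j - i) q"
  by (rule nth_equalityI) (auto simp: base_def)

lemma map_attach_upt [simp]:
  "a \<notin> {i..<j} \<Longrightarrow> map (attach a k w) [i..<j] = map w [i..<j]"
  by (auto simp: attach_def)

text \<open>Three moves across cycle edges: \<open>hang 1\<close> from \<open>2\<close> to
  \<open>1\<close>, then \<open>hang m\<close> from \<open>1\<close> to \<open>0\<close> and from
  \<open>0\<close> to \<open>m + 1\<close>. The intermediate sums are \<open>S 1 1\<close> and
  \<open>S 0 1\<close>.\<close>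

lemma coloring_sum_cycle:
  assumes "finite K" "m \<ge> 1"
  defines "S \<equiv> \<lambda>a b. coloring_sum K {..<m + 2} (cycle_arcs (m + 2)) (attach a m (attach b 1 base))"
  shows "S 1 2 = S (m + 1) 1"
proof -
  let ?V = "{..<m + 2}" and ?C = "cycle_arcs (m + 2)"
  let ?P = "\<lambda>vs a b. path_sum (map (attach a m (attach b 1 base)) vs)"
  \<comment> \<open>\<open>vs\<close> lists the path left when the edge between \<open>u\<close> and
    \<open>v\<close> is deleted from the cycle.\<close>
  have move: "coloring_sum K ?V ?C (attach u j w) - coloring_sum K ?V ?C (attach v j w) =
      path_sum (map (attach u j w) vs) - path_sum (map (attach v j w) vs)"
    if "distinct vs" "set vs = ?V" "?C = chain vs \<union> {(u, v), (v, u)}" "u < m + 2" "v < m + 2"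
    for vs u v j w
  proof -
    have "u \<in> set vs" unfolding that(2) using that(4) by (simp only: lessThan_iff)
    then have "vs \<noteq> []" by (cases vs) simp_all
    then have "coloring_sum K ?V (chain vs) w' = path_sum (map w' vs)" for w'
      using coloring_sum_chain[OF assms(1) that(1)] that(2) by metis
    then show ?thesis
      using that(4,5) coloring_sum_move_factor[of ?V K u v "chain vs" w "hang j"] assms(1)
      unfolding that(3) attach_def by simp
  qed
  have upt2: "[2..<m + 2] = 2 # [Suc 2..<m + 2]"
    by (rule upt_conv_Cons) (use assms(2) in simp)
  have upt1: "[1..<m + 2] = 1 # [2..<m + 2]"
    by (rule upt_conv_Cons[of 1, unfolded Suc_1]) simp
  have upt0: "[0..<m + 2] = 0 # [1..<m + 2]"
    by (rule upt_conv_Cons[of 0, folded One_nat_def]) simp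
  have uptm: "[2..<m + 2] = [2..<m + 1] @ [m + 1]"
    using assms(2) upt_Suc_append[of 2 "m + 1"] by (simp del: upt_Suc)
  have last: "last [i..<m + 2] = m + 1" if "i < m + 2" for i
    using that by (subst last_upt) auto
  have ne: "[i..<m + 2] \<noteq> []" if "i < m + 2" for i
    using that by (simp del: upt_Suc)
  have C0: "?C = chain [0..<m + 2] \<union> {(0, m + 1), (m + 1, 0)}"
    by (simp add: cycle_arcs_def del: upt_Suc)
  have "chain [0..<m + 2] = chain [1..<m + 2] \<union> {(0, 1), (1, 0)}"
    unfolding upt0 unfolding upt1 chain.simps ..
  then have C1: "?C = chain ([1..<m + 2] @ [0]) \<union> {(1, 0), (0, 1)}"
    unfolding C0 using last[of 1] ne[of 1] by (auto simp: chain_snoc simp del: upt_Suc)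
  have "chain [1..<m + 2] = chain [2..<m + 2] \<union> {(1, 2), (2, 1)}"
    unfolding upt1 unfolding upt2 chain.simps ..
  moreover have "chain ([2..<m + 2] @ [0, 1]) =
      chain [2..<m + 2] \<union> {(m + 1, 0), (0, m + 1)} \<union> {(0, 1), (1, 0)}"
    using last[of 2] ne[of 2] chain_snoc[of "[2..<m + 2] @ [0]" 1] assms(2)
    by (simp add: chain_snoc del: upt_Suc)
  ultimately have C2: "?C = chain ([2..<m + 2] @ [0, 1]) \<union> {(2, 1), (1, 2)}"
    unfolding C1 using last[of 1] ne[of 1] by (auto simp: chain_snoc simp del: upt_Suc)
  have m: "Suc (m - 1) = m" and m': "m - 1 + 1 = m" using assms(2) by simp_all
  have b11: "map (attach 1 m (attach 1 1 base)) [2..<m + 2] = replicate m q"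
    and b01: "map (attach 0 m (attach 1 1 base)) [2..<m + 2] = replicate m q"
    by (simp_all del: upt_Suc)
  have rep: "replicate m q = q # replicate (m - 1) q"
    using m by (metis replicate_Suc)
  have "S 1 2 - S 1 1 = ?P ([2..<m + 2] @ [0, 1]) 1 2 - ?P ([2..<m + 2] @ [0, 1]) 1 1"
    unfolding S_def attach_commute[of 1 m]
    by (rule move[OF _ _ C2]) (use assms(2) in auto)
  also have "?P ([2..<m + 2] @ [0, 1]) 1 2 = total (x * hang m * others (x * hang (Suc m)))"
  proof -
    have "map (attach 1 m (attach 2 1 base)) ([2..<m + 2] @ [0, 1]) =
        q * hang 1 # replicate (m - 1) q @ [x, x * hang m]"
      unfolding upt2 by (simp del: upt_Suc) (simp add: attach_def base_def)
    then show ?thesis by (simp only: path_sum_q path_sum.simps others_extend_q m')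
  qed
  also have "?P ([2..<m + 2] @ [0, 1]) 1 1 = total (x * hang m * hang 1 * others (x * hang m))"
  proof -
    \<comment> \<open>\<open>hang 0\<close> is \<open>1\<close>; it gives the first vertex the form
      \<open>q * hang j\<close> that \<open>others_extend_q\<close> expects.\<close>
    have "map (attach 1 m (attach 1 1 base)) ([2..<m + 2] @ [0, 1]) =
        q * hang 0 # replicate (m - 1) q @ [x, x * hang 1 * hang m]"
      unfolding map_append b11 rep by (simp add: attach_def base_def)
    then show ?thesis
      by (simp only: path_sum_q path_sum.simps others_extend_q add_0_right m) (simp only: mult_ac)
  qed
  finally have 1: "S 1 2 - S 1 1 = total (x * hang m * others (x * hang (Suc m)))
    - total (x * hang 1 * hang m * others (x * hang m))" by (simp add: mult_ac)
  have "S 1 1 - S 0 1 = ?P ([1..<m + 2] @ [0]) 1 1 - ?P ([1..<m + 2] @ [0]) 0 1"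
    unfolding S_def
    by (rule move[OF _ _ C1]) (use assms(2) in auto)
  also have "?P ([1..<m + 2] @ [0]) 1 1 = total (x * others (extend m (x * hang 1 * hang m)))"
  proof -
    have "map (attach 1 m (attach 1 1 base)) ([1..<m + 2] @ [0]) =
        x * hang 1 * hang m # replicate m q @ [x]"
      unfolding upt1 map_append list.map b11 by (simp add: attach_def base_def)
    then show ?thesis by (simp only: path_sum_q path_sum.simps)
  qed
  \<comment> \<open>Reading the chain from its other end brings the sum into the form used by
    \<open>tree_relation\<close>.\<close>
  also have "\<dots> = total (x * hang 1 * hang m * others (extend m x))"
    by (rule total_times_others_extend_commute)
  also have "?P ([1..<m + 2] @ [0]) 0 1 = total (x * hang m * others (extend m (x * hang 1)))"
  proof -
    have "map (attach 0 m (attach 1 1 base)) ([1..<m + 2] @ [0]) =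
        x * hang 1 # replicate m q @ [x * hang m]"
      unfolding upt1 map_append list.map b01 by (simp add: attach_def base_def)
    then show ?thesis by (simp only: path_sum_q path_sum.simps)
  qed
  finally have 2: "S 1 1 - S 0 1 = total (x * hang 1 * hang m * others (extend m x))
    - total (x * hang m * others (extend m (x * hang 1)))" .
  have "S 0 1 - S (m + 1) 1 = ?P [0..<m + 2] 0 1 - ?P [0..<m + 2] (m + 1) 1"
    unfolding S_def
    by (rule move[OF _ _ C0]) (use assms(2) in auto)
  also have "?P [0..<m + 2] 0 1 = total (x * hang 1 * hang m * others (x * hang m))"
  proof -
    have "map (attach 0 m (attach 1 1 base)) [0..<m + 2] = x * hang m # x * hang 1 # replicate m q"
      unfolding upt0 upt1 list.map b01 by (simp add: attach_def base_def)
    \<comment> \<open>\<open>path_sum_q\<close> needs a weight after the block of \<open>q\<close>,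
      so the last copy is split off.\<close>
    also have "replicate m q = replicate (m - 1) q @ [q]"
      using m by (metis replicate_Suc replicate_append_same)
    finally have "?P [0..<m + 2] 0 1 = total (extend (Suc (m - 1)) (x * hang 1 * others (x * hang m)))"
      by (simp only: path_sum.simps path_sum_q extend.simps)
    also have "\<dots> = total (x * hang 1 * others (x * hang m) * hang m)"
      using total_extend_times_hang[of m _ 0] by (simp only: m) simp
    finally show ?thesis by (simp add: mult_ac)
  qed
  also have "?P [0..<m + 2] (m + 1) 1 = total (q * hang 1 * hang (2 * m))"
  proof -
    have "map (attach (m + 1) m (attach 1 1 base)) [0..<m + 2] =
        x # x * hang 1 # replicate (m - 1) q @ [q * hang m]"
      unfolding upt0 upt1 uptm using assms(2) by (simp del: upt_Suc) (simp add: attach_def base_def)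
    then have "?P [0..<m + 2] (m + 1) 1 = total (q * hang m * others (extend (m - 1) (x * hang 1 * others x)))"
      by (simp only: path_sum.simps path_sum_q)
    \<comment> \<open>Vertex \<open>0\<close> is bare here and, the cycle being cut, a leaf at
      \<open>1\<close>; this turns \<open>1\<close> into a \<open>q\<close>.\<close>
    also have "x * hang 1 * others x = q * hang 1"
      by (simp add: q_def mult_ac)
    also have "total (q * hang m * others (extend (m - 1) (q * hang 1))) = total (q * hang m * hang (Suc m))"
      using m by (simp only: others_extend_q) simp
    also have "\<dots> = total (q * hang 1 * hang (2 * m))"
      unfolding total_q_hang_hang by (simp add: mult_2)
    finally show ?thesis .
  qed
  finally have 3: "S 0 1 - S (m + 1) 1 = total (x * hang 1 * hang m * others (x * hang m))
    - total (q * hang 1 * hang (2 * m))" .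
  have "S 1 2 - S (m + 1) 1 = (S 1 2 - S 1 1) + (S 1 1 - S 0 1) + (S 0 1 - S (m + 1) 1)"
    by simp
  \<comment> \<open>The second sum of \<open>1\<close> cancels the first sum of \<open>3\<close>;
    \<open>tree_relation\<close> disposes of the other four.\<close>
  also have "\<dots> = 0"
    unfolding 1 2 3 using tree_relation[of m] by (simp add: algebra_simps)
  finally show ?thesis by simp
qed

end

text \<open>
  Only colorings with colors in the support of an exponent vector contribute to its coefficient,
  so finite sets of colors suffice.
\<close>

lemma chromatic_symmetric_function_eq_coloring_sum:
  assumes "finite (pverts G)"
  shows "chromatic_symmetric_function G m =
    Poly_Mapping.lookup (coloring_sum (Poly_Mapping.keys m) (pverts G) (parcs G) (\<lambda>_. indet)) m"
proof -
  let ?K = "Poly_Mapping.keys m" and ?c = "\<lambda>\<kappa>. Poly_Mapping.lookup (coloring_monomial G \<kappa>) m"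
  have keys: "\<kappa> v \<in> ?K" if nz: "?c \<kappa> \<noteq> 0" and "v \<in> pverts G" for \<kappa> v
  proof -
    have "m = (\<Sum>v \<in> pverts G. Poly_Mapping.single (\<kappa> v) 1)"
      using nz by (auto simp: coloring_monomial_eq_single lookup_single when_def split: if_splits)
    then show ?thesis
      using that(2) assms by (auto simp: in_keys_iff lookup_sum lookup_single when_def)
  qed
  have "Poly_Mapping.lookup (coloring_sum ?K (pverts G) (parcs G) (\<lambda>_. indet)) m =
      (\<Sum>\<kappa> \<in> colorings ?K (pverts G) (parcs G). ?c \<kappa>)"
    by (simp add: coloring_sum_def lookup_sum coloring_monomial_def)
  also have "\<dots> = chromatic_symmetric_function G m"
    unfolding chromatic_symmetric_function_def
  proof (rule sum.mono_neutral_right)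
    show "finite (colorings ?K (pverts G) (parcs G))"
      using assms by (simp add: finite_colorings)
  qed (use keys in \<open>auto simp: colorings_def proper_colorings_def PiE_iff\<close>)
  finally show ?thesis ..
qed

section \<open>Isomorphisms, and graphs built from parent functions\<close>

text \<open>A library isomorphism maps vertices and arcs separately. Since both digraphs have
  \<open>fst\<close> and \<open>snd\<close> as tail and head, the vertex map determines the arc
  map.\<close>

lemma digraph_iso_with_projD:
  assumes "digraph_iso (with_proj G) (with_proj H)"
  obtains f where "inj_on f (pverts G)" "pverts H = f ` pverts G" "parcs H = map_prod f f ` parcs G"
proof -
  from assms obtain h where iso: "pre_digraph.digraph_isomorphism (with_proj G) h"
    and H: "with_proj H = app_iso h (with_proj G)"
    unfolding digraph_iso_def by blast
  let ?f = "iso_verts h"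
  have "fst = iso_tail h" "snd = iso_head h"
    using arg_cong[OF H, of tail] arg_cong[OF H, of head] by simp_all
  then have "iso_arcs h e = map_prod ?f ?f e" if "e \<in> parcs G" for e
    using iso that unfolding pre_digraph.digraph_isomorphism_def
    by (auto simp: prod_eq_iff)
  moreover have "parcs H = iso_arcs h ` parcs G"
    using arg_cong[OF H, of arcs] by simp
  ultimately have "parcs H = map_prod ?f ?f ` parcs G" by simp
  moreover have "inj_on ?f (pverts G)"
    using iso by (simp add: pre_digraph.digraph_isomorphism_def)
  moreover have "pverts H = ?f ` pverts G"
    using arg_cong[OF H, of verts] by simp
  ultimately show thesis using that by blast
qed

definition unicyclic_graph :: "nat \<Rightarrow> (nat \<Rightarrow> nat) \<Rightarrow> nat \<Rightarrow> nat pair_pre_digraph" where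
  "unicyclic_graph c p n = \<lparr> pverts = {..<n}, parcs = unicyclic_arcs c p n \<rparr>"

lemma unicyclic_graph_simps [simp]:
  "pverts (unicyclic_graph c p n) = {..<n}" "parcs (unicyclic_graph c p n) = unicyclic_arcs c p n"
  by (simp_all add: unicyclic_graph_def)

lemma chromatic_symmetric_function_unicyclic_eqI:
  assumes "\<And>K (x :: nat \<Rightarrow> (nat \<Rightarrow>\<^sub>0 nat) \<Rightarrow>\<^sub>0 int). finite K \<Longrightarrow>
    coloring_sum K {..<n} (unicyclic_arcs c p n) (\<lambda>_. x) =
    coloring_sum K {..<n} (unicyclic_arcs c p' n) (\<lambda>_. x)"
  shows "chromatic_symmetric_function (unicyclic_graph c p n) =
    chromatic_symmetric_function (unicyclic_graph c p' n)"
  by (rule ext) (simp add: chromatic_symmetric_function_eq_coloring_sum assms)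

lemma unicyclic_arcs_iff:
  "(u, v) \<in> unicyclic_arcs c p n \<longleftrightarrow>
    (u, v) \<in> cycle_arcs c \<or> c \<le> u \<and> u < n \<and> v = p u \<or> c \<le> v \<and> v < n \<and> u = p v"
  by (auto simp: unicyclic_arcs_def)

lemma unicyclic_arcs_sym: "(u, v) \<in> unicyclic_arcs c p n \<Longrightarrow> (v, u) \<in> unicyclic_arcs c p n"
proof -
  have "(v, u) \<in> chain vs" if "(u, v) \<in> chain vs" for vs :: "nat list"
    using that by (induction vs rule: chain.induct) auto
  then show "(u, v) \<in> unicyclic_arcs c p n \<Longrightarrow> (v, u) \<in> unicyclic_arcs c p n"
    by (auto simp: unicyclic_arcs_def cycle_arcs_def)
qed

lemma chromatic_symmetric_function_parent_eq:
  assumes "m \<ge> 1"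
  shows "chromatic_symmetric_function (unicyclic_graph (m + 2) (parent m 1 2) (4 * m + 4)) =
    chromatic_symmetric_function (unicyclic_graph (m + 2) (parent m (m + 1) 1) (4 * m + 4))"
proof (rule chromatic_symmetric_function_unicyclic_eqI)
  fix K :: "nat set" and x :: "nat \<Rightarrow> (nat \<Rightarrow>\<^sub>0 nat) \<Rightarrow>\<^sub>0 int"
  assume K: "finite K"
  show "coloring_sum K {..<4 * m + 4} (unicyclic_arcs (m + 2) (parent m 1 2) (4 * m + 4)) (\<lambda>_. x) =
    coloring_sum K {..<4 * m + 4} (unicyclic_arcs (m + 2) (parent m (m + 1) 1) (4 * m + 4)) (\<lambda>_. x)"
    using color_weights.coloring_sum_parent[OF K, of 1 m 2 x]
      color_weights.coloring_sum_parent[OF K, of "m + 1" m 1 x]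
      color_weights.coloring_sum_cycle[OF K, of m x] assms
    by simp
qed

text \<open>
  In the first graph the only vertex of degree four, \<open>2\<close>, has a neighbor of degree two that is
  adjacent to a leaf; in the second graph \<open>m + 1\<close> has no such neighbor.
\<close>

lemma not_iso_parent:
  assumes "m \<ge> 2"
  shows "\<not> digraph_iso (with_proj (unicyclic_graph (m + 2) (parent m 1 2) (4 * m + 4)))
    (with_proj (unicyclic_graph (m + 2) (parent m (m + 1) 1) (4 * m + 4)))"
proof
  let ?E = "unicyclic_arcs (m + 2) (parent m 1 2) (4 * m + 4)"
  let ?F = "unicyclic_arcs (m + 2) (parent m (m + 1) 1) (4 * m + 4)"
  let ?V = "{..<4 * m + 4}"
  assume "digraph_iso (with_proj (unicyclic_graph (m + 2) (parent m 1 2) (4 * m + 4)))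
    (with_proj (unicyclic_graph (m + 2) (parent m (m + 1) 1) (4 * m + 4)))"
  then obtain f where inj: "inj_on f ?V" and V: "?V = f ` ?V" and F: "?F = map_prod f f ` ?E"
    by (rule digraph_iso_with_projD) auto
  note arcs_iff = unicyclic_arcs_iff cycle_arcs_iff parent_def
  have EV: "u \<in> ?V \<and> v \<in> ?V" if "(u, v) \<in> ?E" for u v
  proof -
    have "?E \<subseteq> ?V \<times> ?V"
      using assms by (intro unicyclic_arcs_subset) (auto simp: parent_def)
    then show ?thesis using that by blast
  qed
  have to: "(f u, f v) \<in> ?F" if "(u, v) \<in> ?E" for u v
    unfolding F using that by force
  have from_F: "\<exists>v. y = f v \<and> (u, v) \<in> ?E" if y: "(f u, y) \<in> ?F" and u: "u \<in> ?V" for u y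
  proof -
    from y obtain u' v where "f u = f u'" "y = f v" "(u', v) \<in> ?E"
      unfolding F by auto
    moreover from this have "u = u'"
      using EV u inj by (auto dest: inj_onD)
    ultimately show ?thesis by blast
  qed
  \<comment> \<open>In the second graph only \<open>m + 1\<close> has degree four; for any other
    vertex at most three possible neighbors are listed.\<close>
  have deg: "u = m + 1" if "(u, a) \<in> ?F" "(u, b) \<in> ?F" "(u, d) \<in> ?F" "(u, e) \<in> ?F" "distinct [a, b, d, e]"
    for u a b d e
  proof (rule ccontr)
    assume u: "u \<noteq> m + 1"
    have "\<exists>n1 n2 n3. \<forall>v. (u, v) \<in> ?F \<longrightarrow> v = n1 \<or> v = n2 \<or> v = n3"
    proof -
      consider "u = 0" | "u = 1" | "2 \<le> u" "u < m + 1" | "m + 2 \<le> u" "u < 2 * m + 2" | "2 * m + 2 \<le> u"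
        using u by linarith
      then show ?thesis
      proof cases
        case 1
        have "\<forall>v. (u, v) \<in> ?F \<longrightarrow> v = 1 \<or> v = m + 1 \<or> v = m + 1"
          using 1 assms by (auto simp: arcs_iff split: if_splits)
        then show ?thesis by blast
      next
        case 2
        have "\<forall>v. (u, v) \<in> ?F \<longrightarrow> v = 0 \<or> v = 2 \<or> v = 4 * m + 2"
          using 2 assms by (auto simp: arcs_iff split: if_splits)
        then show ?thesis by blast
      next
        case 3
        have "\<forall>v. (u, v) \<in> ?F \<longrightarrow> v = u - 1 \<or> v = u + 1 \<or> v = u + m"
          using 3 assms by (auto simp: arcs_iff split: if_splits)
        then show ?thesis by blast
      next
        case 4
        have "\<forall>v. (u, v) \<in> ?F \<longrightarrow> v = u - m \<or> v = u - m \<or> v = u - m"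
          using 4 assms by (auto simp: arcs_iff split: if_splits) presburger
        then show ?thesis by blast
      next
        case 5
        have "\<forall>v. (u, v) \<in> ?F \<longrightarrow> v = parent m (m + 1) 1 u \<or> v = u + 1 \<or> v = u + 2"
          using 5 assms by (auto simp: unicyclic_arcs_iff cycle_arcs_iff) (auto simp: parent_def split: if_splits)
        then show ?thesis by blast
      qed
    qed
    with that show False by (auto; metis)
  qed
  \<comment> \<open>\<open>?s\<close> is the neighbor of \<open>2\<close> that has degree two, and
    \<open>?l\<close> is its leaf.\<close>
  let ?s = "4 * m + 2" and ?l = "4 * m + 3"
  have s_nbr: "v = 2 \<or> v = ?l" if "(?s, v) \<in> ?E" for v
    using that assms by (auto simp: arcs_iff split: if_splits)
  have l_nbr: "v = ?s" if "(?l, v) \<in> ?E" for v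
    using that assms by (auto simp: arcs_iff split: if_splits)
  have E: "(2, 1) \<in> ?E" "(2, 3) \<in> ?E" "(2, m + 2) \<in> ?E" "(2, ?s) \<in> ?E" "(?s, ?l) \<in> ?E"
    using assms by (auto simp: arcs_iff)
  have "distinct [f 1, f 3, f (m + 2), f ?s]"
    using inj assms by (auto simp: inj_on_eq_iff)
  with E(1-4) have f2: "f 2 = m + 1" by (intro deg[OF to to to to])
  have fs: "y = m + 1 \<or> y = f ?l" if "(f ?s, y) \<in> ?F" for y
    using from_F[OF that] s_nbr f2 by auto
  have fl: "y = f ?s" if "(f ?l, y) \<in> ?F" for y
    using from_F[OF that] l_nbr by auto
  have "f ?l \<noteq> f 2"
    using inj by (auto simp: inj_on_eq_iff)
  then have fl_ne: "f ?l \<noteq> m + 1" using f2 by simp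
  have "(m + 1, f ?s) \<in> ?F" using to[OF E(4)] f2 by simp
  \<comment> \<open>None of the four neighbors of \<open>m + 1\<close> can be \<open>f ?s\<close>:
    \<open>m\<close> and \<open>2 * m + 2\<close> have two further neighbors, the other neighbor
    \<open>1\<close> of \<open>0\<close> is no leaf, and \<open>2 * m + 1\<close> is a leaf
    itself.\<close>
  then consider "f ?s = m" | "f ?s = 0" | "f ?s = 2 * m + 1" | "f ?s = 2 * m + 2"
    using assms by (auto simp: arcs_iff split: if_splits)
  then show False
  proof cases
    case 1
    have "(m, m - 1) \<in> ?F" "(m, 2 * m) \<in> ?F"
      using assms by (auto simp: arcs_iff)
    with 1 fs[of "m - 1"] fs[of "2 * m"] assms show False by auto
  next
    case 2
    have "(0, 1) \<in> ?F" "(1, 2) \<in> ?F"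
      using assms by (auto simp: arcs_iff)
    with 2 fs[of 1] fl[of 2] assms show False by auto
  next
    case 3
    have "v = m + 1" if "(2 * m + 1, v) \<in> ?F" for v
      using that assms by (auto simp: arcs_iff split: if_splits) presburger
    with 3 have "f ?l = m + 1"
      using to[OF E(5)] by simp
    with fl_ne show False ..
  next
    case 4
    have "(2 * m + 2, 2 * m + 3) \<in> ?F" "(2 * m + 2, 2 * m + 4) \<in> ?F"
      using assms by (auto simp: arcs_iff)
    with 4 fs[of "2 * m + 3"] fs[of "2 * m + 4"] assms show False by auto
  qed
qed

section \<open>The pair of graphs for triangles\<close>

text \<open>Vertex \<open>2\<close> is added to the edge between \<open>0\<close> and
  \<open>1\<close>; the two colors it must avoid are distinct, so each is subtracted once.\<close>

lemma (in color_weights) coloring_sum_triangle: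
  assumes "finite K"
  shows "coloring_sum K {..<3} (cycle_arcs 3) w =
    total (w 2) * total (w 1 * others (w 0)) - total (w 1 * others (w 0 * w 2))
      - total (w 1 * w 2 * others (w 0))"
proof -
  let ?E = "chain [0, 1 :: nat]"
  have edge: "coloring_sum K {0, 1} ?E w' = total (w' 1 * others (w' 0))" for w' :: "nat \<Rightarrow> 'k \<Rightarrow> 'r"
    using coloring_sum_chain[OF assms, of "[0, 1]" w'] by simp
  have V: "{..<3} = insert 2 {0, 1 :: nat}" by auto
  have C: "cycle_arcs 3 = ?E \<union> {2} \<times> {0, 1} \<union> {0, 1} \<times> {2}"
    by (auto simp: cycle_arcs_def eval_nat_numeral)
  let ?P = "\<lambda>\<kappa>. \<Prod>u \<in> {0, 1}. w u (\<kappa> u)"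
  have "coloring_sum K {..<3} (cycle_arcs 3) w =
      (\<Sum>\<kappa> \<in> colorings K {0, 1} ?E. ?P \<kappa> * sum (w 2) (K - \<kappa> ` {0, 1}))"
    unfolding V C using assms by (intro coloring_sum_insert) auto
  also have "\<dots> = (\<Sum>\<kappa> \<in> colorings K {0, 1} ?E.
      total (w 2) * ?P \<kappa> - ?P \<kappa> * w 2 (\<kappa> 0) - ?P \<kappa> * w 2 (\<kappa> 1))"
  proof (rule sum.cong)
    fix \<kappa> assume "\<kappa> \<in> colorings K {0, 1} ?E"
    then have "\<kappa> 0 \<in> K" "\<kappa> 1 \<in> K" "\<kappa> 0 \<noteq> \<kappa> 1"
      by (auto simp: colorings_def)
    then have "sum (w 2) (K - \<kappa> ` {0, 1}) = total (w 2) - w 2 (\<kappa> 0) - w 2 (\<kappa> 1)"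
      using assms by (subst sum_diff) (auto simp: total_def)
    then show "?P \<kappa> * sum (w 2) (K - \<kappa> ` {0, 1}) =
        total (w 2) * ?P \<kappa> - ?P \<kappa> * w 2 (\<kappa> 0) - ?P \<kappa> * w 2 (\<kappa> 1)"
      by (simp only: right_diff_distrib) (simp add: mult.commute)
  qed simp
  also have "\<dots> = total (w 2) * coloring_sum K {0, 1} ?E w
      - coloring_sum K {0, 1} ?E (w(0 := w 0 * w 2)) - coloring_sum K {0, 1} ?E (w(1 := w 1 * w 2))"
    unfolding coloring_sum_def
    by (subst (1 2) prod_fun_upd_times) (simp_all only: sum_subtractf sum_distrib_left finite.intros insertI1 insertI2)
  also have "\<dots> = total (w 2) * total (w 1 * others (w 0)) - total (w 1 * others (w 0 * w 2))
      - total (w 1 * w 2 * others (w 0))"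
    unfolding edge by simp
  finally show ?thesis .
qed

definition net_parent :: "nat \<Rightarrow> nat" where
  "net_parent v = v - 3"

definition broom_parent :: "nat \<Rightarrow> nat" where
  "broom_parent v = (if v = 5 then 4 else 0)"

text \<open>The cycle weights are \<open>q\<close>, \<open>q\<close>, \<open>q\<close> for the net
  and \<open>q * others q\<close>, \<open>x\<close>, \<open>x\<close> for the broom. In the triangle
  formula the two \<open>x\<close> combine into \<open>q = x * others x\<close>, and with
  \<open>?A = q * others q\<close> both sums become \<open>total q * total ?A\<close> minus twice
  \<open>total (q * ?A)\<close>.\<close>

lemma (in color_weights) coloring_sum_net_eq_broom:
  assumes "finite K"
  shows "coloring_sum K {..<6} (unicyclic_arcs 3 net_parent 6) (\<lambda>_. x) =
    coloring_sum K {..<6} (unicyclic_arcs 3 broom_parent 6) (\<lambda>_. x)"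
proof -
  let ?C = "coloring_sum K {..<3} (cycle_arcs 3)"
  have step: "coloring_sum K {..<6} (unicyclic_arcs 3 p 6) w = ?C (w3(p 3 := w3 (p 3) * others (w3 3)))"
    if "\<And>v. 3 \<le> v \<Longrightarrow> p v < v" "w1 = w(p 5 := w (p 5) * others (w 5))"
      "w3 = w1(p 4 := w1 (p 4) * others (w1 4))" for p w w1 w3
    using coloring_sum_unicyclic_Suc[OF assms, of 3 5 p w] coloring_sum_unicyclic_Suc[OF assms, of 3 4 p w1]
      coloring_sum_unicyclic_Suc[OF assms, of 3 3 p w3] that
    by (simp add: eval_nat_numeral)
  have "coloring_sum K {..<6} (unicyclic_arcs 3 net_parent 6) (\<lambda>_. x) = ?C (\<lambda>_. q)"
    by (subst step[OF _ refl refl]) (auto simp: net_parent_def q_def intro!: coloring_sum_cong)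
  moreover have "coloring_sum K {..<6} (unicyclic_arcs 3 broom_parent 6) (\<lambda>_. x) = ?C ((\<lambda>_. x)(0 := q * others q))"
    by (subst step[OF _ refl refl]) (auto simp: broom_parent_def q_def mult_ac intro!: coloring_sum_cong)
  moreover have "?C ((\<lambda>_. x)(0 := q * others q)) = ?C (\<lambda>_. q)"
  proof -
    let ?A = "q * others q"
    have "?C ((\<lambda>_. x)(0 := ?A)) =
        total x * total (x * others ?A) - total (x * others (?A * x)) - total (x * x * others ?A)"
      by (simp add: coloring_sum_triangle[OF assms])
    also have "\<dots> = (total x * total x - total (x * x)) * total ?A
        - (total x * total (x * ?A) - total (x * x * ?A))
        - (total (x * ?A) * total x - total (x * x * ?A))"
      unfolding total_times_others[of x] total_times_others[of "x * x"]
      by (simp add: algebra_simps)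
    also have "total x * total x - total (x * x) = total q"
      using total_times_others[of x x] by (simp add: q_def)
    also have "total (x * ?A) * total x - total (x * x * ?A) = total (q * ?A)"
      using total_times_others[of "x * ?A" x] by (simp add: q_def mult_ac)
    also have "total x * total (x * ?A) - total (x * x * ?A) = total (q * ?A)"
      using total_times_others[of "x * ?A" x] by (simp add: q_def mult_ac)
    also have "total q * total ?A - total (q * ?A) - total (q * ?A) = ?C (\<lambda>_. q)"
      using total_times_others_commute[of q "q * q"]
      by (simp add: coloring_sum_triangle[OF assms] mult_ac)
    finally show ?thesis .
  qed
  ultimately show ?thesis by simp
qed

lemma chromatic_symmetric_function_net_eq_broom:
  "chromatic_symmetric_function (unicyclic_graph 3 net_parent 6) =
    chromatic_symmetric_function (unicyclic_graph 3 broom_parent 6)"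
  by (intro chromatic_symmetric_function_unicyclic_eqI color_weights.coloring_sum_net_eq_broom)

text \<open>Vertex \<open>0\<close> of the broom has four neighbors, while no vertex of the net has
  more than three.\<close>

lemma not_iso_net_broom:
  "\<not> digraph_iso (with_proj (unicyclic_graph 3 net_parent 6)) (with_proj (unicyclic_graph 3 broom_parent 6))"
proof
  let ?E = "unicyclic_arcs 3 net_parent 6" and ?F = "unicyclic_arcs 3 broom_parent 6"
  assume "digraph_iso (with_proj (unicyclic_graph 3 net_parent 6)) (with_proj (unicyclic_graph 3 broom_parent 6))"
  then obtain f where inj: "inj_on f {..<6}" and V: "{..<6} = f ` {..<6}" and F: "?F = map_prod f f ` ?E"
    by (rule digraph_iso_with_projD) auto
  have E: "?E \<subseteq> {..<6} \<times> {..<6}"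
    by (intro unicyclic_arcs_subset) (auto simp: net_parent_def)
  from V obtain u where u: "u < 6" "f u = 0" by (metis image_iff lessThan_iff zero_less_numeral)
  let ?N = "{v. (u, v) \<in> ?E}"
  have "{1, 2, 3, 4} \<subseteq> {y. (0, y) \<in> ?F}"
    by (auto simp: unicyclic_arcs_iff cycle_arcs_iff broom_parent_def)
  also have "\<dots> \<subseteq> f ` ?N"
  proof
    fix y assume "y \<in> {y. (0, y) \<in> ?F}"
    then obtain u' v where uv: "f u' = 0" "y = f v" "(u', v) \<in> ?E"
      unfolding F by auto
    then have "u' \<in> {..<6}" using E by blast
    then have "u' = u" using inj_onD[OF inj, of u' u] uv(1) u by simp
    with uv show "y \<in> f ` ?N" by blast
  qed
  finally have sub: "{1, 2, 3, 4} \<subseteq> f ` ?N" .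
  have "\<exists>a b c. ?N \<subseteq> {a, b, c}"
  proof -
    consider "u = 0" | "u = 1" | "u = 2" | "u \<ge> 3" by linarith
    then show ?thesis
    proof cases
      case 1
      have "?N \<subseteq> {1, 2, 3}"
        using 1 by (auto simp: unicyclic_arcs_iff cycle_arcs_iff net_parent_def)
      then show ?thesis by blast
    next
      case 2
      have "?N \<subseteq> {0, 2, 4}"
        using 2 by (auto simp: unicyclic_arcs_iff cycle_arcs_iff net_parent_def)
      then show ?thesis by blast
    next
      case 3
      have "?N \<subseteq> {0, 1, 5}"
        using 3 by (auto simp: unicyclic_arcs_iff cycle_arcs_iff net_parent_def)
      then show ?thesis by blast
    next
      case 4
      have "?N \<subseteq> {u - 3, u - 3, u - 3}"
        using 4 by (auto simp: unicyclic_arcs_iff cycle_arcs_iff net_parent_def)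
      then show ?thesis by blast
    qed
  qed
  then obtain a b c where "?N \<subseteq> {a, b, c}" by blast
  then have "{1, 2, 3, 4} \<subseteq> {f a, f b, f c}" using sub by blast
  then have "card {1, 2, 3, 4 :: nat} \<le> card {f a, f b, f c}" by (intro card_mono) auto
  also have "\<dots> \<le> 3" by (simp add: card_insert_if)
  finally show False by simp
qed

section \<open>Unicyclicity\<close>

lemma pcas_nth:
  assumes "pcas u p v" "p \<noteq> []"
  shows "fst (hd p) = u" "snd (last p) = v" "\<And>i. Suc i < length p \<Longrightarrow> snd (p ! i) = fst (p ! Suc i)"
proof -
  have "fst (hd p) = u \<and> snd (last p) = v \<and> (\<forall>i. Suc i < length p \<longrightarrow> snd (p ! i) = fst (p ! Suc i))"
    using assms
  proof (induction p arbitrary: u)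
    case (Cons e es)
    show ?case
    proof (cases es)
      case (Cons e' es')
      with Cons.IH[of "snd e"] Cons.prems have *: "fst (hd es) = snd e" "snd (last es) = v"
        "\<And>i. Suc i < length es \<Longrightarrow> snd (es ! i) = fst (es ! Suc i)" by auto
      have "snd ((e # es) ! i) = fst ((e # es) ! Suc i)" if "Suc i < length (e # es)" for i
        using that * Cons by (cases i) auto
      then show ?thesis using Cons.prems * Cons by auto
    qed (use Cons.prems in auto)
  qed simp
  then show "fst (hd p) = u" "snd (last p) = v" "\<And>i. Suc i < length p \<Longrightarrow> snd (p ! i) = fst (p ! Suc i)"
    by auto
qed

text \<open>These facts about the arc set are what uniqueness of the cycle is derived from; the last
  one excludes that a cycle turns back at a vertex.\<close>

lemma cycle_no_backtrack:
  assumes "pre_digraph.cycle (with_proj G) p" "3 \<le> length p"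
  shows "set p \<subseteq> parcs G" "p \<noteq> []" "fst ` set p = snd ` set p"
    and "\<And>v. v \<in> fst ` set p \<Longrightarrow> \<exists>a b. (a, v) \<in> set p \<and> (v, b) \<in> set p \<and> a \<noteq> b"
proof -
  from assms obtain u where sub: "set p \<subseteq> parcs G" and cas: "pcas u p u" and ne: "p \<noteq> []"
    and dist: "distinct (tl (pawalk_verts u p))"
    unfolding pre_digraph.cycle_def pre_digraph.awalk_def
    by (auto simp: cas_with_proj_eq awalk_verts_with_proj_eq)
  let ?n = "length p"
  note nth = pcas_nth[OF cas ne]
  have "map snd p = tl (pawalk_verts u p)"
    using pre_digraph.awalk_verts_conv'[of "with_proj G" u p u] cas ne
    by (simp add: cas_with_proj_eq awalk_verts_with_proj_eq)
  with dist have dist_snd: "distinct (map snd p)" by simp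
  \<comment> \<open>Positions are read cyclically: the first arc follows the last.\<close>
  have snd_fst: "snd (p ! i) = fst (p ! (Suc i mod ?n))" if "i < ?n" for i
  proof (cases "Suc i < ?n")
    case False
    with that have "Suc i = ?n" by simp
    then have i: "i = ?n - 1" "Suc i mod ?n = 0" by auto
    then show ?thesis
      using nth(1,2) ne by (simp add: hd_conv_nth last_conv_nth)
  qed (use nth(3) in auto)
  show "set p \<subseteq> parcs G" "p \<noteq> []" by (fact sub) (fact ne)
  have next_ex: "\<exists>i < ?n. Suc i mod ?n = j" if "j < ?n" for j
    using that ne by (cases j) (auto intro: exI[of _ "?n - 1"] exI[of _ "j - 1"])
  show "fst ` set p = snd ` set p"
  proof (intro equalityI subsetI)
    fix v assume "v \<in> fst ` set p"
    then obtain j where "j < ?n" "v = fst (p ! j)" by (auto simp: in_set_conv_nth)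
    with next_ex snd_fst show "v \<in> snd ` set p" by (metis image_eqI nth_mem)
  next
    fix v assume "v \<in> snd ` set p"
    then obtain i where "i < ?n" "v = snd (p ! i)" by (auto simp: in_set_conv_nth)
    moreover have "Suc i mod ?n < ?n" using ne by simp
    ultimately show "v \<in> fst ` set p" using snd_fst by (metis image_eqI nth_mem)
  qed
  fix v assume "v \<in> fst ` set p"
  then obtain j where j: "j < ?n" "v = fst (p ! j)" by (auto simp: in_set_conv_nth)
  then obtain i where i: "i < ?n" "Suc i mod ?n = j" using next_ex by blast
  then obtain h where h: "h < ?n" "Suc h mod ?n = i" using next_ex by blast
  have "snd (p ! h) = fst (p ! i)" "snd (p ! i) = v"
    using snd_fst[OF h(1)] snd_fst[OF i(1)] h(2) i(2) j(2) by simp_all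
  \<comment> \<open>\<open>h\<close>, \<open>i\<close>, \<open>j\<close> are consecutive modulo
    \<open>?n\<close>, so \<open>h = j\<close> would force \<open>?n\<close> to divide 2.\<close>
  moreover have "h \<noteq> j"
    using h i j assms(2) by (auto simp: mod_Suc split: if_splits)
  then have "snd (p ! h) \<noteq> snd (p ! j)"
    using dist_snd h(1) j(1) by (metis distinct_conv_nth length_map nth_map)
  ultimately have "(fst (p ! i), v) = p ! i" "(v, snd (p ! j)) = p ! j" "fst (p ! i) \<noteq> snd (p ! j)"
    using j by (auto simp: prod_eq_iff)
  then show "\<exists>a b. (a, v) \<in> set p \<and> (v, b) \<in> set p \<and> a \<noteq> b"
    using i(1) j(1) by (metis nth_mem)
qed

locale unicyclic_parent =
  fixes c n :: nat and p :: "nat \<Rightarrow> nat"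
  assumes c: "c \<ge> 3" and n: "c \<le> n" and parent_less: "\<And>v. c \<le> v \<Longrightarrow> v < n \<Longrightarrow> p v < v"
begin

abbreviation "G \<equiv> unicyclic_graph c p n"
abbreviation "A \<equiv> unicyclic_arcs c p n"

lemma arcs_subset: "A \<subseteq> {..<n} \<times> {..<n}"
  using c n parent_less by (intro unicyclic_arcs_subset) auto

lemma arcs_irrefl: "(v, v) \<notin> A"
  using c parent_less[of v] by (auto simp: unicyclic_arcs_iff cycle_arcs_iff)

lemma pair_graph: "pair_graph G"
proof
  show "finite (parcs G)"
    using arcs_subset by (auto intro: finite_subset)
  show "symmetric (with_proj G)"
    by (auto simp: symmetric_def sym_def intro: unicyclic_arcs_sym)
qed (use arcs_subset arcs_irrefl in auto)

lemma connected: "Digraph_Component.connected (with_proj G)"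
proof -
  interpret pair_graph G by (rule pair_graph)
  have to0: "v \<rightarrow>\<^sup>*\<^bsub>with_proj G\<^esub> 0" if "v < n" for v
    using that
  proof (induction v rule: less_induct)
    case (less v)
    show ?case
    proof (cases "v = 0")
      case True
      then show ?thesis using less.prems by (simp add: reachable_refl)
    next
      case False
      \<comment> \<open>Every vertex but \<open>0\<close> has a neighbor with a smaller number, so
        descent reaches \<open>0\<close>.\<close>
      define u where "u = (if v < c then v - 1 else p v)"
      have u: "u < v" "(v, u) \<in> A"
        using False less.prems parent_less[of v] c
        by (auto simp: u_def unicyclic_arcs_iff cycle_arcs_iff)
      then have "(v, u) \<in> parcs G" by simp
      moreover have "u \<rightarrow>\<^sup>*\<^bsub>with_proj G\<^esub> 0" using u(1) less by auto
      ultimately show ?thesis by (rule adj_reachable_trans)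
    qed
  qed
  have "u \<rightarrow>\<^sup>*\<^bsub>with_proj G\<^esub> v" if "u < n" "v < n" for u v
  proof -
    have "0 \<rightarrow>\<^sup>*\<^bsub>with_proj G\<^esub> v"
      using symmetric_reachable[OF sym_arcs to0[OF that(2)]] .
    with to0[OF that(1)] show ?thesis by (rule reachable_trans)
  qed
  moreover have "n \<noteq> 0" using c n by simp
  ultimately show ?thesis
    by (auto simp: connected_def strongly_connected_def reachable_mk_symmetric_eq[OF sym_arcs])
qed

text \<open>Each vertex of the walk has two neighbors on it. A largest vertex outside
  \<open>{..<c}\<close> would have only its parent; so the walk stays inside \<open>{..<c}\<close>,
  where every vertex has just two neighbors and both must be used.\<close>

lemma cycle_eq:
  assumes "pre_digraph.cycle (with_proj G) w" "3 \<le> length w"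
  shows "subgraph_of_walk w = \<lparr> pverts = {..<c}, parcs = cycle_arcs c \<rparr>"
proof -
  note cyc = cycle_no_backtrack[OF assms]
  let ?V = "fst ` set w" and ?B = "set w \<union> (set w)\<inverse>"
  have B: "?B \<subseteq> A"
    using cyc(1) unicyclic_arcs_sym by auto
  have nbrs: "\<exists>a b. (v, a) \<in> ?B \<and> (v, b) \<in> ?B \<and> a \<noteq> b" if "v \<in> ?V" for v
    using cyc(4)[OF that] by blast
  have BV: "u \<in> ?V \<and> v \<in> ?V" if "(u, v) \<in> ?B" for u v
    using that cyc(3) by (metis Un_iff converse_iff fst_conv image_eqI snd_conv)
  have fin: "finite ?V" and ne: "?V \<noteq> {}" using cyc(2) by auto
  have Vc: "v < c" if "v \<in> ?V" for v
  proof -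
    let ?M = "Max ?V"
    have "?M \<in> ?V" using fin ne by (rule Max_in)
    then obtain a b where ab: "(?M, a) \<in> ?B" "(?M, b) \<in> ?B" "a \<noteq> b" using nbrs by blast
    have parent: "d = p ?M" if "(?M, d) \<in> ?B" "c \<le> ?M" for d
    proof -
      have "d \<le> ?M" using BV[OF that(1)] fin by (intro Max_ge) auto
      moreover have "(?M, d) \<in> A" using that(1) B by blast
      ultimately show ?thesis
        using that(2) parent_less[of d] c by (auto simp: unicyclic_arcs_iff cycle_arcs_iff)
    qed
    have "?M < c" using parent[OF ab(1)] parent[OF ab(2)] ab(3) by force
    moreover have "v \<le> ?M" using that fin by simp
    ultimately show ?thesis by simp
  qed
  have BC: "?B \<subseteq> cycle_arcs c"
  proof
    fix e assume e: "e \<in> ?B"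
    obtain u v where uv: "e = (u, v)" by fastforce
    then have "u < c" "v < c" "(u, v) \<in> A" using e BV[of u v] Vc B by blast+
    then show "e \<in> cycle_arcs c" by (simp add: uv unicyclic_arcs_iff)
  qed
  have full: "(u, v) \<in> ?B" if "u \<in> ?V" "(u, v) \<in> cycle_arcs c" for u v
  proof -
    from nbrs[OF that(1)] obtain a b where ab: "(u, a) \<in> ?B" "(u, b) \<in> ?B" "a \<noteq> b" by blast
    then have "(u, a) \<in> cycle_arcs c" "(u, b) \<in> cycle_arcs c" using BC by blast+
    with that(2) ab(3) have "v = a \<or> v = b"
      using c by (auto simp: cycle_arcs_iff)
    with ab show ?thesis by blast
  qed
  have up: "Suc v \<in> ?V" if "v \<in> ?V" "Suc v < c" for v
    using full[of v "Suc v"] BV[of v "Suc v"] that c by (auto simp: cycle_arcs_iff)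
  have down: "v \<in> ?V" if "Suc v \<in> ?V" for v
    using full[of "Suc v" v] BV[of "Suc v" v] that Vc[of "Suc v"] c by (auto simp: cycle_arcs_iff)
  have zero: "0 \<in> ?V" if "v \<in> ?V" for v
    using that
  proof (induction v)
    case (Suc v)
    show ?case by (rule Suc.IH[OF down[OF Suc.prems]])
  qed
  have all: "v \<in> ?V" if "v < c" for v
    using that
  proof (induction v)
    case 0
    from ne obtain v where "v \<in> ?V" by (meson ex_in_conv)
    then show ?case by (rule zero)
  next
    case (Suc v)
    show ?case by (rule up[OF Suc.IH Suc.prems]) (use Suc.prems in simp)
  qed
  have "?V = {..<c}" using all Vc by blast
  moreover have "?B = cycle_arcs c"
  proof
    show "cycle_arcs c \<subseteq> ?B"
    proof
      fix e assume e: "e \<in> cycle_arcs c"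
      obtain u v where "e = (u, v)" by fastforce
      with e full[of u v] all[of u] c show "e \<in> ?B" by (auto simp: cycle_arcs_iff)
    qed
  qed (fact BC)
  ultimately show ?thesis
    using cyc(3) by (simp add: subgraph_of_walk_def)
qed

lemma cycle_ex: "\<exists>w. pre_digraph.cycle (with_proj G) w \<and> 3 \<le> length w"
proof -
  let ?w = "map (\<lambda>i. (i, Suc i)) [0..<c - 1]"
  \<comment> \<open>Stated for any start \<open>i\<close>, so that downward induction from
    \<open>k\<close> applies.\<close>
  have cas: "pcas i (map (\<lambda>i. (i, Suc i)) [i..<k] @ [(k, 0)]) 0" if "i \<le> k" for i k
    using that by (induction i rule: inc_induct) (auto simp: upt_conv_Cons simp del: upt_Suc)
  have verts: "pawalk_verts i (map (\<lambda>i. (i, Suc i)) [i..<k] @ [(k, 0)]) = [i..<Suc k] @ [0]" if "i \<le> k" for i k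
    using that by (induction i rule: inc_induct) (auto simp: upt_conv_Cons simp del: upt_Suc)
  have "pre_digraph.cycle (with_proj G) (?w @ [(c - 1, 0)])"
    unfolding pre_digraph.cycle_def pre_digraph.awalk_def
  proof (intro exI[of _ 0] conjI)
    show "pre_digraph.cas (with_proj G) 0 (?w @ [(c - 1, 0)]) 0"
      using cas[of 0 "c - 1"] by (simp add: cas_with_proj_eq)
    show "set (?w @ [(c - 1, 0)]) \<subseteq> arcs (with_proj G)"
      using c by (auto simp: unicyclic_arcs_iff cycle_arcs_iff)
    show "distinct (tl (pre_digraph.awalk_verts (with_proj G) 0 (?w @ [(c - 1, 0)])))"
      using c by (simp add: awalk_verts_with_proj_eq verts tl_append upt_conv_Cons del: upt_Suc)
  qed (use c n in auto)
  moreover have "3 \<le> length (?w @ [(c - 1, 0)])" using c by simp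
  ultimately show ?thesis by blast
qed

lemma cycle_subgraphs: "cycle_subgraphs G = {\<lparr> pverts = {..<c}, parcs = cycle_arcs c \<rparr>}"
  unfolding cycle_subgraphs_def using cycle_eq cycle_ex by auto metis

lemma c_unicyclic: "c_unicyclic c G"
  unfolding c_unicyclic_def unicyclic_def cycle_subgraphs
  using pair_graph connected by simp

lemma girth: "girth G = enat c"
  by (simp add: girth_def cycle_subgraphs)

end

theorem corollary4p14:
  fixes c :: nat
  assumes "c \<ge> 3"
  shows "\<exists>(G :: nat pair_pre_digraph) (H :: nat pair_pre_digraph).
           c_unicyclic c G \<and> c_unicyclic c H \<and>
           girth G = enat c \<and> girth H = enat c \<and>
           \<not> digraph_iso (with_proj G) (with_proj H) \<and>
           chromatic_symmetric_function G = chromatic_symmetric_function H"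
proof (cases "c = 3")
  case True
  have "unicyclic_parent 3 6 net_parent" "unicyclic_parent 3 6 broom_parent"
    by unfold_locales (auto simp: net_parent_def broom_parent_def)
  then show ?thesis
    unfolding True
    using unicyclic_parent.c_unicyclic unicyclic_parent.girth
      not_iso_net_broom chromatic_symmetric_function_net_eq_broom by blast
next
  case False
  define m where "m = c - 2"
  have m: "c = m + 2" "m \<ge> 2" using assms False by (auto simp: m_def)
  have "unicyclic_parent (m + 2) (4 * m + 4) (parent m 1 2)"
    "unicyclic_parent (m + 2) (4 * m + 4) (parent m (m + 1) 1)"
    using m(2) by (unfold_locales; auto simp: parent_def)+
  then show ?thesis
    unfolding m(1)
    using unicyclic_parent.c_unicyclic unicyclic_parent.girth
      not_iso_parent[OF m(2)] chromatic_symmetric_function_parent_eq[of m] m(2) by fastforce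
qed

end
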